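(* Let $k\ge 3$ be an integer. Up to isomorphism, the excluded minors for $\mathcal{P}_{U_{2,4}}^k$ on a ground set $E=\{e,f,g,h\}$ of size $4$ are exactly the following five $k$-polymatroids (each with $\rho(\emptyset)=0$): - $Ex_{(4,0,0)}^2=U_{2,4}$: every singleton has rank $1$ and every subset of size at least $2$ has rank $2$. Its $k$-dual is $Ex_{(0,0,4)}^{4k-2}$. - $Ex_{(3,0,1)}^{k+1}$: $\rho(e)=\rho(f)=\rho(g)=1$, $\rho(h)=k$; $\rho(ef)=\rho(eg)=\rho(fg)=2$, $\rho(eh)=\rho(fh)=\rho(gh)=k+1$; $\rho(efg)=2$, $\rho(efh)=\rho(egh)=\rho(fgh)=k+1$; $\rho(E)=k+1$. Its $k$-dual is $Ex_{(1,0,3)}^{3k-1}$. - $Ex_{(2,0,2)}^{2k}$: $\rho(e)=\rho(f)=1$, $\rho(g)=\rho(h)=k$; $\rho(ef)=2$, $\rho(eg)=\rho(eh)=\rho(fg)=\rho(fh)=k+1$, $\rho(gh)=2k$; $\rho(efg)=\rho(efh)=k+1$, $\rho(egh)=\rho(fgh)=2k$; $\rho(E)=2k$. It is self-$k$-dual. - $Ex_{(1,0,3)}^{3k-1}$: $\rho(e)=1$, $\rho(f)=\rho(g)=\rho(h)=k$; $\rho(ef)=\rho(eg)=\rho(eh)=k+1$, $\rho(fg)=\rho(fh)=\rho(gh)=2k$; $\rho(efg)=\rho(efh)=\rho(egh)=2k$, $\rho(fgh)=3k-1$; $\rho(E)=3k-1$. Its $k$-dual is $Ex_{(3,0,1)}^{k+1}$.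 - $Ex_{(0,0,4)}^{4k-2}$: every singleton has rank $k$, every $2$-element subset has rank $2k$, every $3$-element subset has rank $3k-1$, and $\rho(E)=4k-2$. Its $k$-dual is $U_{2,4}$.
   Context: A polymatroid is a pair $(E,\rho)$ where $E$ is a finite set and $\rho:2^E\to\mathbb{Z}$ satisfies $\rho(\emptyset)=0$, monotonicity and submodularity ($\rho(A)+\rho(B)\ge\rho(A\cap B)+\rho(A\cup B)$). For an integer $k\ge 1$, a $k$-polymatroid is a polymatroid with $\rho(\{e\})\le k$ for all $e\in E$. We write $\rho(e)$, $\rho(ef)$, $\rho(efg)$ for $\rho(\{e\})$, $\rho(\{e,f\})$, $\rho(\{e,f,g\})$, etc. Two polymatroids are isomorphic if there is a rank-preserving bijection between their ground sets. For $X\subseteq E$, the deletion $\rho\backslash X$ and contraction $\rho/X$ are the polymatroids on $E-X$ given by $(\rho\backslash X)(Y)=\rho(Y)$ and $(\rho/X)(Y)=\rho(X\cup Y)-\rho(X)$. A minor of $\rho$ is a polymatroid $(\rho\backslash X)/Y$ with $X,Y\subseteq E$ disjoint; it is proper if $X\cup Y\ne\emptyset$. The $k$-natural matroid $M_\rho^k$ of a $k$-polymatroid $(E,\rho)$: for each $e\in E$ let $X_e$ be a set of $k$ elements, with $X_e\cap X_f=\emptyset$ for $e\neq f$; for $A\subseteq E$ let $X_A=\bigcup_{e\in A}X_e$. Then $M_\rho^k$ is the matroid on $X_E$ with rank function $r(X)=\min\{\rho(A)+|X-X_A| : A\subseteq E\}$. $\mathcal{P}_{U_{2,4}}^k$ denotes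 the class of $k$-polymatroids whose $k$-natural matroid is binary (representable over $\mathbb{F}_2$). An excluded minor for $\mathcal{P}_{U_{2,4}}^k$ is a $k$-polymatroid that is not in $\mathcal{P}_{U_{2,4}}^k$ but all of whose proper minors are in $\mathcal{P}_{U_{2,4}}^k$. The $k$-dual of a $k$-polymatroid $(E,\rho)$ is the $k$-polymatroid $(E,\rho^* )$ with $\rho^*(X)=k|X|+\rho(E-X)-\rho(E)$. We call $\rho$ self-$k$-dual if $(E,\rho)\cong(E,\rho^* )$. Statements "its $k$-dual is ..." are up to isomorphism. *)

theory Defs
  imports Complex_Main "HOL-Library.Z2" "HOL-Library.Function_Algebras"
begin

text \<open>
  A polymatroid is a pair of a ground set and a rank function. The rank function is a total
  function on sets, but only its values on subsets of the ground set are meaningful: every notion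
  below, including isomorphism, ignores the other values.
\<close>

type_synonym 'a polymatroid = "'a set \<times> ('a set \<Rightarrow> int)"

fun is_polymatroid :: "'a polymatroid \<Rightarrow> bool" where
  "is_polymatroid (E, \<rho>) \<longleftrightarrow>
     finite E \<and> \<rho> {} = 0 \<and>
     (\<forall>A B. A \<subseteq> B \<and> B \<subseteq> E \<longrightarrow> \<rho> A \<le> \<rho> B) \<and>
     (\<forall>A B. A \<subseteq> E \<and> B \<subseteq> E \<longrightarrow> \<rho> A + \<rho> B \<ge> \<rho> (A \<inter> B) + \<rho> (A \<union> B))"

fun is_k_polymatroid :: "nat \<Rightarrow> 'a polymatroid \<Rightarrow> bool" where
  "is_k_polymatroid k (E, \<rho>) \<longleftrightarrow> is_polymatroid (E, \<rho>) \<and> (\<forall>e\<in>E. \<rho> {e} \<le> int k)"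

fun polymatroid_iso :: "'a polymatroid \<Rightarrow> 'b polymatroid \<Rightarrow> bool" (infix "\<cong>\<^sub>p" 50) where
  "(E, \<rho>) \<cong>\<^sub>p (F, \<sigma>) \<longleftrightarrow> (\<exists>\<phi>. bij_betw \<phi> E F \<and> (\<forall>X\<subseteq>E. \<sigma> (\<phi> ` X) = \<rho> X))"

fun deletion :: "'a polymatroid \<Rightarrow> 'a set \<Rightarrow> 'a polymatroid" where
  "deletion (E, \<rho>) X = (E - X, \<rho>)"

fun contraction :: "'a polymatroid \<Rightarrow> 'a set \<Rightarrow> 'a polymatroid" where
  "contraction (E, \<rho>) X = (E - X, \<lambda>Y. \<rho> (X \<union> Y) - \<rho> X)"

definition proper_minor :: "'a polymatroid \<Rightarrow> 'a polymatroid \<Rightarrow> bool" where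
  "proper_minor Q P \<longleftrightarrow>
     (\<exists>X Y. X \<subseteq> fst P \<and> Y \<subseteq> fst P \<and> X \<inter> Y = {} \<and> X \<union> Y \<noteq> {} \<and>
        Q = contraction (deletion P X) Y)"

fun k_dual :: "nat \<Rightarrow> 'a polymatroid \<Rightarrow> 'a polymatroid" where
  "k_dual k (E, \<rho>) = (E, \<lambda>X. int k * int (card X) + \<rho> (E - X) - \<rho> E)"

definition self_k_dual :: "nat \<Rightarrow> 'a polymatroid \<Rightarrow> bool" where
  "self_k_dual k P \<longleftrightarrow> P \<cong>\<^sub>p k_dual k P"

text \<open>
  Matroids are likewise given by ground set and rank function. In the \<open>k\<close>-natural matroid the
  \<open>k\<close>-element set \<open>X\<^sub>e\<close> is \<open>{e} \<times> {..<k}\<close>, hence \<open>X\<^sub>A = A \<times> {..<k}\<close>.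
\<close>

fun natural_matroid :: "nat \<Rightarrow> 'a polymatroid \<Rightarrow> ('a \<times> nat) polymatroid" where
  "natural_matroid k (E, \<rho>) =
     (E \<times> {..<k}, \<lambda>X. Min {\<rho> A + int (card (X - A \<times> {..<k})) | A. A \<subseteq> E})"

definition fun_scale :: "'f::field \<Rightarrow> (nat \<Rightarrow> 'f) \<Rightarrow> nat \<Rightarrow> 'f" where
  "fun_scale c v = (\<lambda>i. c * v i)"

lemma vector_space_fun_scale: "vector_space fun_scale"
  by unfold_locales (auto simp: fun_scale_def fun_eq_iff algebra_simps)

text \<open>
  Representability over the field \<open>'f\<close> by vectors in \<open>'f\<^sup>n\<close>, which is taken to be the space of
  sequences vanishing from position \<open>n\<close> on. The rank of \<open>X\<close> is the dimension of the span of the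
  vectors labelled by \<open>X\<close>; distinct elements may carry equal vectors.
\<close>

fun representable_over :: "'f::field itself \<Rightarrow> 'a polymatroid \<Rightarrow> bool" where
  "representable_over _ (E, r) \<longleftrightarrow>
     (\<exists>n. \<exists>v :: 'a \<Rightarrow> nat \<Rightarrow> 'f.
        (\<forall>x\<in>E. \<forall>i\<ge>n. v x i = 0) \<and>
        (\<forall>X\<subseteq>E. r X = int (vector_space.dim fun_scale (v ` X))))"

definition binary :: "'a polymatroid \<Rightarrow> bool" where
  "binary M \<longleftrightarrow> representable_over TYPE(bit) M"

definition in_P_U24 :: "nat \<Rightarrow> 'a polymatroid \<Rightarrow> bool" where
  "in_P_U24 k P \<longleftrightarrow> is_k_polymatroid k P \<and> binary (natural_matroid k P)"

definition excluded_minor_P_U24 :: "nat \<Rightarrow> 'a polymatroid \<Rightarrow> bool" where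
  "excluded_minor_P_U24 k P \<longleftrightarrow>
     is_k_polymatroid k P \<and> \<not> in_P_U24 k P \<and> (\<forall>Q. proper_minor Q P \<longrightarrow> in_P_U24 k Q)"

datatype four = e4 | f4 | g4 | h4

definition rank_table :: "(four set \<times> int) list \<Rightarrow> four polymatroid" where
  "rank_table t = ({e4, f4, g4, h4}, \<lambda>X. the (map_of t X))"

definition U24 :: "four polymatroid" where
  "U24 = ({e4, f4, g4, h4}, \<lambda>X. if X = {} then 0 else if card X = 1 then 1 else 2)"

definition Ex_3_0_1 :: "nat \<Rightarrow> four polymatroid" where
  "Ex_3_0_1 k = rank_table
     [({}, 0),
      ({e4}, 1), ({f4}, 1), ({g4}, 1), ({h4}, int k),
      ({e4, f4}, 2), ({e4, g4}, 2), ({f4, g4}, 2),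
      ({e4, h4}, int k + 1), ({f4, h4}, int k + 1), ({g4, h4}, int k + 1),
      ({e4, f4, g4}, 2),
      ({e4, f4, h4}, int k + 1), ({e4, g4, h4}, int k + 1), ({f4, g4, h4}, int k + 1),
      ({e4, f4, g4, h4}, int k + 1)]"

definition Ex_2_0_2 :: "nat \<Rightarrow> four polymatroid" where
  "Ex_2_0_2 k = rank_table
     [({}, 0),
      ({e4}, 1), ({f4}, 1), ({g4}, int k), ({h4}, int k),
      ({e4, f4}, 2),
      ({e4, g4}, int k + 1), ({e4, h4}, int k + 1),
      ({f4, g4}, int k + 1), ({f4, h4}, int k + 1),
      ({g4, h4}, 2 * int k),
      ({e4, f4, g4}, int k + 1), ({e4, f4, h4}, int k + 1),
      ({e4, g4, h4}, 2 * int k), ({f4, g4, h4}, 2 * int k),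
      ({e4, f4, g4, h4}, 2 * int k)]"

definition Ex_1_0_3 :: "nat \<Rightarrow> four polymatroid" where
  "Ex_1_0_3 k = rank_table
     [({}, 0),
      ({e4}, 1), ({f4}, int k), ({g4}, int k), ({h4}, int k),
      ({e4, f4}, int k + 1), ({e4, g4}, int k + 1), ({e4, h4}, int k + 1),
      ({f4, g4}, 2 * int k), ({f4, h4}, 2 * int k), ({g4, h4}, 2 * int k),
      ({e4, f4, g4}, 2 * int k), ({e4, f4, h4}, 2 * int k), ({e4, g4, h4}, 2 * int k),
      ({f4, g4, h4}, 3 * int k - 1),
      ({e4, f4, g4, h4}, 3 * int k - 1)]"

definition Ex_0_0_4 :: "nat \<Rightarrow> four polymatroid" where
  "Ex_0_0_4 k = ({e4, f4, g4, h4}, \<lambda>X.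
     if X = {} then 0
     else if card X = 1 then int k
     else if card X = 2 then 2 * int k
     else if card X = 3 then 3 * int k - 1
     else 4 * int k - 2)"

end

theory Submission
  imports Defs
begin

text \<open>
  Let \<open>k \<ge> 3\<close>. The excluded minors on four elements are the polymatroids obtained from the four
  point line \<open>U\<^sub>2\<^sub>,\<^sub>4\<close> by choosing a set \<open>S\<close> of points and adding \<open>k - 1\<close> to the rank for each
  element of \<open>S\<close>, that is, those with rank function \<open>min |X| 2 + (k - 1) |X \<inter> S|\<close>. Their
  isomorphism type is determined by the size of \<open>S\<close>, which gives five of them, and \<open>k\<close>-duality
  replaces \<open>S\<close> by its complement.

  The reason is a description of the natural matroid. Let \<open>r\<close> be the rank function of a matroid
  \<open>N\<close> on \<open>E\<close>. The natural matroid of \<open>r(X) + (k - 1) |X \<inter> S|\<close> replaces each element of \<open>N\<close>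
  outside \<open>S\<close> by \<open>k\<close> parallel elements and each element of \<open>S\<close> by \<open>k\<close> elements in series. Its
  rank function is computed in \<open>natural_rank_series_parallel\<close>. A binary representation of \<open>N\<close>
  therefore extends to the natural matroid (\<open>binary_natural_matroid_series_parallel\<close>), whereas for
  \<open>N = U\<^sub>2\<^sub>,\<^sub>4\<close> contracting all but one element of each series class exhibits the four point line
  in the natural matroid (\<open>line_extension_not_in_P_U24\<close>).

  Conversely, suppose that all proper minors of a polymatroid with at least three elements are in
  the class. By looking for four point lines in natural matroids on one and two elements one finds
  that an element of rank at least \<open>k - 1\<close> keeps marginal rank at least \<open>k - 1\<close> over every set,
  and that all other elements have rank at most one. Subtracting \<open>k - 1\<close> for every element of the
  first kind leaves a matroid (\<open>matroid_of_binary_proper_minors\<close>), so the polymatroid has the form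
  just described. If it is not in the class, then \<open>N\<close> is not binary, and a matroid on at most four
  elements that is not binary is \<open>U\<^sub>2\<^sub>,\<^sub>4\<close> (\<open>binary_of_card_le_4\<close>).
\<close>

section \<open>Dimension in sequence spaces\<close>

interpretation seq: vector_space "fun_scale :: 'f::field \<Rightarrow> (nat \<Rightarrow> 'f) \<Rightarrow> nat \<Rightarrow> 'f"
  by (rule vector_space_fun_scale)

lemma (in vector_space) dim_insert_of_finite:
  assumes "finite S"
  shows "dim (insert x S) = dim S + (if x \<in> span S then 0 else 1)"
proof (cases "x \<in> span S")
  case True
  then show ?thesis
    using span_eq_dim[OF span_redundant[OF True]] by simp
next
  case False
  obtain B where B: "B \<subseteq> S" "independent B" "S \<subseteq> span B" "card B = dim S"
    by (rule basis_exists)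
  have fin: "finite B"
    using B(1) assms finite_subset by blast
  have sp: "span B = span S"
    using span_mono[OF B(1)] span_minimal[OF B(3) subspace_span] by (rule subset_antisym)
  have "x \<notin> B"
    using False sp span_base by blast
  moreover have "independent (insert x B)"
    using False sp B(2) independent_insertI by blast
  moreover have "span (insert x B) = span (insert x S)"
    using sp by (simp add: span_insert)
  ultimately have "dim (insert x S) = card B + 1"
    using dim_eq_card[of "insert x B" "insert x S"] fin by simp
  then show ?thesis
    using False B(4) by simp
qed

lemma zero_coordinate_on_span:
  assumes "x \<in> seq.span S" "\<And>y. y \<in> S \<Longrightarrow> y p = (0 :: 'f::field)"
  shows "x p = 0"
proof -
  have "seq.subspace {y :: nat \<Rightarrow> 'f. y p = 0}"
    unfolding seq.subspace_def by (auto simp: fun_scale_def)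
  then have "seq.span S \<subseteq> {y. y p = 0}"
    using assms(2) by (intro seq.span_minimal) auto
  then show ?thesis
    using assms(1) by blast
qed

text \<open>
  Vectors that each own a coordinate, on which everything else vanishes, are independent of each
  other and of the rest. Representations are verified by exhibiting such coordinates.
\<close>

lemma dim_union_private_coordinates:
  fixes w :: "'j \<Rightarrow> nat \<Rightarrow> 'f::field"
  assumes "finite Y" "finite J"
    and "\<And>j. j \<in> J \<Longrightarrow> w j (p j) \<noteq> 0"
    and "\<And>i j. i \<in> J \<Longrightarrow> j \<in> J \<Longrightarrow> i \<noteq> j \<Longrightarrow> w i (p j) = 0"
    and "\<And>y j. y \<in> Y \<Longrightarrow> j \<in> J \<Longrightarrow> y (p j) = 0"
  shows "seq.dim (Y \<union> w ` J) = seq.dim Y + card J"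
  using assms(2-5)
proof (induction J rule: finite_induct)
  case empty
  then show ?case by simp
next
  case (insert j J)
  have "w j \<notin> seq.span (Y \<union> w ` J)"
  proof
    assume "w j \<in> seq.span (Y \<union> w ` J)"
    then have "w j (p j) = 0"
      by (rule zero_coordinate_on_span) (use insert in auto)
    then show False
      using insert.prems(1) by simp
  qed
  moreover have "finite (Y \<union> w ` J)"
    using assms(1) insert.hyps by simp
  ultimately have "seq.dim (insert (w j) (Y \<union> w ` J)) = seq.dim (Y \<union> w ` J) + 1"
    using seq.dim_insert_of_finite[of "Y \<union> w ` J" "w j"] by simp
  then show ?case
    using insert by simp
qed

section \<open>Detecting nonbinary matroids\<close>

lemma binaryE:
  assumes "binary (E, r)"
  obtains n and v :: "'a \<Rightarrow> nat \<Rightarrow> bit"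
  where "\<And>x i. x \<in> E \<Longrightarrow> n \<le> i \<Longrightarrow> v x i = 0" "\<And>X. X \<subseteq> E \<Longrightarrow> r X = int (seq.dim (v ` X))"
  using assms unfolding binary_def representable_over.simps by blast

lemma binaryI:
  fixes v :: "'a \<Rightarrow> nat \<Rightarrow> bit"
  assumes "\<And>x i. x \<in> E \<Longrightarrow> n \<le> i \<Longrightarrow> v x i = 0" "\<And>X. X \<subseteq> E \<Longrightarrow> r X = int (seq.dim (v ` X))"
  shows "binary (E, r)"
proof -
  have "(\<forall>x\<in>E. \<forall>i\<ge>n. v x i = 0) \<and> (\<forall>X\<subseteq>E. r X = int (seq.dim (v ` X)))"
    using assms by simp
  then show ?thesis
    unfolding binary_def representable_over.simps by (intro exI)
qed

text \<open>
  The hypothesis says that contracting \<open>C\<close> and restricting to \<open>T\<close> gives the four point line. Over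
  the two-element field a two-dimensional quotient has only three nonzero vectors, so two of the
  four points would coincide.
\<close>

lemma not_binary_of_four_point_line:
  assumes bin: "binary (E, r)" and fin: "finite E"
    and sub: "C \<subseteq> E" "T \<subseteq> E" and card: "card T = 4"
    and rank: "\<And>X. X \<subseteq> T \<Longrightarrow> r (C \<union> X) = r C + min (int (card X)) 2"
  shows False
proof -
  obtain v :: "'a \<Rightarrow> nat \<Rightarrow> bit" where v: "\<And>X. X \<subseteq> E \<Longrightarrow> r X = int (seq.dim (v ` X))"
    by (rule binaryE[OF bin]) blast
  have finC: "finite C"
    using sub fin finite_subset by blast
  obtain a b c d where T: "T = {a, b, c, d}" "distinct [a, b, c, d]"
  proof -
    have "finite T"
      using sub fin finite_subset by blast
    then obtain xs where xs: "set xs = T" "distinct xs"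
      using finite_distinct_list by blast
    then have "length xs = 4"
      using card distinct_card[of xs] by simp
    then obtain a b c d where "xs = [a, b, c, d]"
      by (auto simp: numeral_eq_Suc length_Suc_conv)
    then show ?thesis
      using that[of a b c d] xs by simp
  qed
  let ?W = "v ` C"
  define D where "D X = int (seq.dim (?W \<union> v ` X))" for X
  have D: "D X = r C + min (int (card X)) 2" if "X \<subseteq> T" for X
    using rank[OF that] v[of "C \<union> X"] that sub by (auto simp: D_def image_Un)
  have finX: "finite (?W \<union> v ` X)" if "X \<subseteq> T" for X
    using finC that T by (auto intro: finite_subset[of X])
  have step: "D (insert x X) = D X + (if v x \<in> seq.span (?W \<union> v ` X) then 0 else 1)"
    if "insert x X \<subseteq> T" for x X
  proof -
    have "?W \<union> v ` insert x X = insert (v x) (?W \<union> v ` X)"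
      by auto
    then show ?thesis
      using seq.dim_insert_of_finite[OF finX[of X], of "v x"] that by (simp add: D_def)
  qed
  have notin: "v x \<notin> seq.span (insert (v y) ?W)" if "x \<in> T" "y \<in> T" "x \<noteq> y" for x y
    using step[of x "{y}"] D[of "{y}"] D[of "{x, y}"] that by (auto split: if_splits)
  have inn: "v x \<in> seq.span (insert (v y) (insert (v z) ?W))"
    if "x \<in> T" "y \<in> T" "z \<in> T" "distinct [x, y, z]" for x y z
    using step[of x "{y, z}"] D[of "{y, z}"] D[of "{x, y, z}"] that
    by (auto split: if_splits simp: insert_commute)
  have third: "v x - v a - v b \<in> seq.span ?W" if "x \<in> T" "x \<noteq> a" "x \<noteq> b" for x
  proof -
    have "v x \<in> seq.span (insert (v a) (insert (v b) ?W))"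
      using inn[of x a b] that T by auto
    then obtain \<alpha> \<beta> where *: "v x - fun_scale \<alpha> (v a) - fun_scale \<beta> (v b) \<in> seq.span ?W"
      unfolding seq.span_breakdown_eq by blast
    have "\<alpha> \<noteq> 0"
    proof
      assume "\<alpha> = 0"
      then have "v x \<in> seq.span (insert (v b) ?W)"
        using * by (auto simp: seq.span_breakdown_eq)
      then show False
        using notin[of x b] that T by auto
    qed
    moreover have "\<beta> \<noteq> 0"
    proof
      assume "\<beta> = 0"
      then have "v x \<in> seq.span (insert (v a) ?W)"
        using * by (auto simp: seq.span_breakdown_eq)
      then show False
        using notin[of x a] that T by auto
    qed
    ultimately have "\<alpha> = 1" "\<beta> = 1"
      by (simp_all only: bit_not_zero_iff)
    then show ?thesis
      using * by simp
  qed
  have cancel: "x - p - q - (y - p - q) = x - y" for x y p q :: "'g::ab_group_add"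
    by simp
  have "v c - v a - v b \<in> seq.span ?W" "v d - v a - v b \<in> seq.span ?W"
    using T by (auto intro!: third)
  from seq.span_diff[OF this] have "v c - v d \<in> seq.span ?W"
    unfolding cancel .
  then have "v c - fun_scale 1 (v d) \<in> seq.span ?W"
    by simp
  then have "v c \<in> seq.span (insert (v d) ?W)"
    unfolding seq.span_breakdown_eq by blast
  then show False
    using notin[of c d] T by auto
qed

section \<open>Natural matroids on one and two elements\<close>

lemma natural_rank_eqI:
  fixes \<rho> :: "'a set \<Rightarrow> int" and k :: nat
  assumes "finite E"
    and "\<And>A. A \<subseteq> E \<Longrightarrow> m \<le> \<rho> A + int (card (X - A \<times> {..<k}))"
    and "B \<subseteq> E" "\<rho> B + int (card (X - B \<times> {..<k})) = m"
  shows "Min {\<rho> A + int (card (X - A \<times> {..<k})) | A. A \<subseteq> E} = m"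
proof -
  define g where "g A = \<rho> A + int (card (X - A \<times> {..<k}))" for A
  have "Min (g ` Pow E) = m"
  proof (rule Min_eqI)
    show "m \<in> g ` Pow E"
      using assms(3,4) unfolding g_def by blast
    show "m \<le> y" if "y \<in> g ` Pow E" for y
      using that assms(2) unfolding g_def by blast
  qed (simp add: assms(1))
  moreover have "{g A | A. A \<subseteq> E} = g ` Pow E"
    unfolding image_def by blast
  ultimately show ?thesis
    by (simp add: g_def)
qed

text \<open>
  The natural matroid of a single element is uniform on \<open>k\<close> elements. If its rank \<open>\<rho>\<close> satisfies
  \<open>2 \<le> \<rho> \<le> k - 2\<close>, contracting \<open>\<rho> - 2\<close> of them leaves rank two on at least four elements.
\<close>

lemma single_rank_of_in_P_U24:
  assumes "in_P_U24 k ({e}, \<sigma>)"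
  shows "\<sigma> {e} \<le> 1 \<or> \<sigma> {e} \<ge> int k - 1"
proof (rule ccontr)
  assume "\<not> ?thesis"
  then obtain i where i: "\<sigma> {e} = int i + 2" "i + 4 \<le> k"
    by (intro that[of "nat (\<sigma> {e} - 2)"]) linarith+
  define r where "r = (\<lambda>X. Min {\<sigma> A + int (card (X - A \<times> {..<k})) | A. A \<subseteq> {e}})"
  have \<sigma>: "\<sigma> {} = 0"
    using assms by (simp add: in_P_U24_def)
  have bin: "binary ({e} \<times> {..<k}, r)"
    using assms unfolding in_P_U24_def natural_matroid.simps r_def by blast
  have rank: "r ({e} \<times> {..<i} \<union> Z) = int i + min (int (card Z)) 2" if "Z \<subseteq> {e} \<times> {i..<i + 4}" for Z
  proof -
    have fin: "finite Z"
      using that finite_subset by blast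
    have "({e} \<times> {..<i}) \<inter> Z = {}"
      using that by auto
    then have c: "card ({e} \<times> {..<i} \<union> Z) = i + card Z"
      using fin by (simp add: card_Un_disjoint)
    have "({e} \<times> {..<i} \<union> Z) - {e} \<times> {..<k} = {}"
      using that i by fastforce
    then have d: "card (({e} \<times> {..<i} \<union> Z) - {e} \<times> {..<k}) = 0"
      by (simp only: card.empty)
    show ?thesis
      unfolding r_def
      by (rule natural_rank_eqI[where B = "if card Z \<le> 2 then {} else {e}"])
         (use \<sigma> i c d in \<open>auto simp: subset_singleton_iff simp del: Un_Diff\<close>)
  qed
  show False
  proof (rule not_binary_of_four_point_line[OF bin])
    show "r ({e} \<times> {..<i} \<union> X) = r ({e} \<times> {..<i}) + min (int (card X)) 2"
      if "X \<subseteq> {e} \<times> {i..<i + 4}" for X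
      using rank[OF that] rank[of "{}"] by simp
  qed (use i in auto)
qed

text \<open>
  Contract \<open>i\<close> copies of \<open>e\<close> and \<open>j\<close> copies of \<open>f\<close>, so that rank two is left, and restrict to
  \<open>m\<close> further copies of \<open>e\<close> and \<open>n\<close> of \<open>f\<close>. The copies are placed freely, so the four remaining
  elements form a line as long as each class keeps enough rank for any two of them.
\<close>

lemma pair_four_point_line:
  assumes P: "in_P_U24 k ({e, f}, \<sigma>)" and "e \<noteq> f"
    and e: "\<sigma> {e} \<ge> int i + 2"
    and f: "\<sigma> {f} \<ge> int j + 2 \<or> \<sigma> {f} \<ge> int j + 1 \<and> n \<le> 1"
    and ef: "\<sigma> {e, f} = int i + int j + 2"
    and "m + n = 4" "i + m \<le> k" "j + n \<le> k"
  shows False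
proof -
  define r where "r = (\<lambda>X. Min {\<sigma> A + int (card (X - A \<times> {..<k})) | A. A \<subseteq> {e, f}})"
  have \<sigma>: "\<sigma> {} = 0"
    using P by (simp add: in_P_U24_def)
  have bin: "binary ({e, f} \<times> {..<k}, r)"
    using P unfolding in_P_U24_def natural_matroid.simps r_def by blast
  define C where "C = {e} \<times> {..<i} \<union> {f} \<times> {..<j}"
  define T where "T = {e} \<times> {i..<i + m} \<union> {f} \<times> {j..<j + n}"
  have rank: "r (C \<union> Z) = int (i + j) + min (int (card Z)) 2" if Z: "Z \<subseteq> T" for Z
  proof -
    obtain Ze Zf where split: "Z = Ze \<union> Zf"
      and part: "Ze \<subseteq> {e} \<times> {i..<i + m}" "Zf \<subseteq> {f} \<times> {j..<j + n}"
    proof (rule that)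
      show "Z = (Z \<inter> {e} \<times> {i..<i + m}) \<union> (Z \<inter> {f} \<times> {j..<j + n})"
        using Z unfolding T_def by blast
    qed blast+
    have fin: "finite Ze" "finite Zf"
      using part by (auto intro: finite_subset)
    have disj: "Ze \<inter> Zf = {}" "({e} \<times> {..<i}) \<inter> Ze = {}" "({f} \<times> {..<j}) \<inter> Zf = {}"
      "({e} \<times> {..<i} \<union> Ze) \<inter> ({f} \<times> {..<j} \<union> Zf) = {}"
      using part \<open>e \<noteq> f\<close> by fastforce+
    have card: "card Z = card Ze + card Zf"
      using fin disj(1) unfolding split by (rule card_Un_disjoint)
    have n: "card Zf \<le> n"
      using card_mono[OF _ part(2)] by simp
    have ce: "card ({e} \<times> {..<i} \<union> Ze) = i + card Ze"
      using fin disj by (simp add: card_Un_disjoint)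
    have cf: "card ({f} \<times> {..<j} \<union> Zf) = j + card Zf"
      using fin disj by (simp add: card_Un_disjoint)
    have "C \<union> Z = ({e} \<times> {..<i} \<union> Ze) \<union> ({f} \<times> {..<j} \<union> Zf)"
      unfolding split C_def by blast
    then have c: "card (C \<union> Z) = i + card Ze + (j + card Zf)"
      using card_Un_disjoint[OF _ _ disj(4)] fin ce cf by simp
    have inside: "Ze \<subseteq> {e} \<times> {..<k}" "Zf \<subseteq> {f} \<times> {..<k}"
      "{e} \<times> {..<i} \<subseteq> {e} \<times> {..<k}" "{f} \<times> {..<j} \<subseteq> {f} \<times> {..<k}"
      using part \<open>i + m \<le> k\<close> \<open>j + n \<le> k\<close> by fastforce+
    have "(C \<union> Z) - {e} \<times> {..<k} = {f} \<times> {..<j} \<union> Zf"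
      using inside \<open>e \<noteq> f\<close> unfolding split C_def by blast
    then have de: "card ((C \<union> Z) - {e} \<times> {..<k}) = j + card Zf"
      using cf by simp
    have "(C \<union> Z) - {f} \<times> {..<k} = {e} \<times> {..<i} \<union> Ze"
      using inside \<open>e \<noteq> f\<close> unfolding split C_def by blast
    then have df: "card ((C \<union> Z) - {f} \<times> {..<k}) = i + card Ze"
      using ce by simp
    have "(C \<union> Z) - {e, f} \<times> {..<k} = {}"
      using inside unfolding split C_def by blast
    then have none: "card ((C \<union> Z) - {e, f} \<times> {..<k}) = 0"
      by (simp only: card.empty)
    define X where "X = C \<union> Z"
    note ranks = c[folded X_def] de[folded X_def] df[folded X_def] none[folded X_def]
    have cases: "A = {} \<or> A = {e} \<or> A = {f} \<or> A = {e, f}" if "A \<subseteq> {e, f}" for A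
      using that by auto
    have lower: "int (i + j) + min (int (card Z)) 2 \<le> \<sigma> A + int (card (X - A \<times> {..<k}))"
      if "A \<subseteq> {e, f}" for A
      using cases[OF that] ranks \<sigma> e f ef card n by auto
    show ?thesis
    proof (cases "card Z \<le> 2")
      case True
      show ?thesis
        unfolding r_def X_def[symmetric]
        by (rule natural_rank_eqI[where B = "{}", OF _ lower]) (use ranks True \<sigma> card in auto)
    next
      case False
      show ?thesis
        unfolding r_def X_def[symmetric]
        by (rule natural_rank_eqI[where B = "{e, f}", OF _ lower]) (use ranks False ef in auto)
    qed
  qed
  show False
  proof (rule not_binary_of_four_point_line[OF bin])
    show "r (C \<union> X) = r C + min (int (card X)) 2" if "X \<subseteq> T" for X
      using rank[OF that] rank[of "{}"] by simp
    show "card T = 4"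
      unfolding T_def using \<open>e \<noteq> f\<close> \<open>m + n = 4\<close> by (subst card_Un_disjoint) auto
  qed (use assms in \<open>auto simp: C_def T_def\<close>)
qed

text \<open>
  If the rank of \<open>e\<close> drops by two or more over \<open>f\<close>, two copies of each element form a four point
  line. A drop by exactly one below \<open>k - 1\<close> means that \<open>e\<close> has rank \<open>k - 1\<close>; there is then one more
  copy of \<open>e\<close> than its rank, and three copies of \<open>e\<close> together with one copy of \<open>f\<close> form the line.
\<close>

lemma pair_rank_of_in_P_U24:
  assumes P: "in_P_U24 k ({e, f}, \<sigma>)" and "e \<noteq> f" and "k \<ge> 3" and e: "\<sigma> {e} \<ge> int k - 1"
  shows "\<sigma> {e, f} - \<sigma> {f} \<ge> int k - 1"
proof (rule ccontr)
  assume small: "\<not> ?thesis"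
  have pm: "is_k_polymatroid k ({e, f}, \<sigma>)"
    using P by (simp add: in_P_U24_def)
  then have bound: "\<sigma> {e} \<le> int k" "\<sigma> {f} \<le> int k"
    by auto
  have "\<sigma> {e} \<le> \<sigma> {e, f}" "\<sigma> {f} \<le> \<sigma> {e, f}"
    using pm by auto
  \<comment> \<open>How far \<open>f\<close> lowers the rank of \<open>e\<close> is also how far \<open>e\<close> lowers the rank of \<open>f\<close>.\<close>
  define drop where "drop = \<sigma> {e} + \<sigma> {f} - \<sigma> {e, f}"
  note facts = small bound \<open>\<sigma> {e} \<le> \<sigma> {e, f}\<close> \<open>\<sigma> {f} \<le> \<sigma> {e, f}\<close> drop_def e \<open>k \<ge> 3\<close>
  show False
  proof (cases "drop \<ge> 2")
    case True
    \<comment> \<open>Contract as many copies of \<open>f\<close> as possible and make up the rest with copies of \<open>e\<close>.\<close>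
    define j where "j = min (\<sigma> {f} - 2) (\<sigma> {e, f} - 2)"
    have j: "0 \<le> j" "j \<le> \<sigma> {f} - 2" "j \<le> \<sigma> {e, f} - 2" "\<sigma> {e, f} - j \<le> \<sigma> {e}"
      using facts True unfolding j_def by linarith+
    show False
      by (rule pair_four_point_line[OF P \<open>e \<noteq> f\<close>, of "nat (\<sigma> {e, f} - 2 - j)" "nat j" 2 2])
         (use j bound in linarith)+
  next
    case False
    show False
      by (rule pair_four_point_line[OF P \<open>e \<noteq> f\<close>, of "nat (\<sigma> {e} - 2)" "nat (\<sigma> {f} - 1)" 1 3])
         (use facts False in linarith)+
  qed
qed

section \<open>Series-parallel extensions of matroids\<close>

text \<open>
  A matroid is a \<open>1\<close>-polymatroid \<open>(E, r)\<close>. The following is the rank function of the polymatroid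
  whose natural matroid replaces each element outside \<open>S\<close> by \<open>k\<close> parallel copies and each element
  of \<open>S\<close> by \<open>k\<close> elements in series.
\<close>

definition series_parallel :: "nat \<Rightarrow> 'a set \<Rightarrow> ('a set \<Rightarrow> int) \<Rightarrow> 'a set \<Rightarrow> int" where
  "series_parallel k S r A = r A + (int k - 1) * int (card (A \<inter> S))"

lemma card_Int_modular:
  fixes c :: int
  assumes "finite A" "finite B"
  shows "c * int (card (A \<inter> S)) + c * int (card (B \<inter> S))
    = c * int (card (A \<inter> B \<inter> S)) + c * int (card ((A \<union> B) \<inter> S))"
proof -
  have "(A \<inter> S) \<union> (B \<inter> S) = (A \<union> B) \<inter> S" "(A \<inter> S) \<inter> (B \<inter> S) = A \<inter> B \<inter> S"
    by auto
  then have "card (A \<inter> S) + card (B \<inter> S) = card ((A \<union> B) \<inter> S) + card (A \<inter> B \<inter> S)"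
    using card_Un_Int[of "A \<inter> S" "B \<inter> S"] assms by simp
  then have "int (card (A \<inter> S)) + int (card (B \<inter> S))
      = int (card (A \<inter> B \<inter> S)) + int (card ((A \<union> B) \<inter> S))"
    by linarith
  then show ?thesis
    by (simp only: distrib_left[symmetric])
qed

lemma rank_mono_of_increments:
  fixes r :: "'a set \<Rightarrow> int"
  assumes "finite E" "\<And>A e. A \<subseteq> E \<Longrightarrow> e \<in> E - A \<Longrightarrow> r A \<le> r (insert e A)" "A \<subseteq> B" "B \<subseteq> E"
  shows "r A \<le> r B"
proof -
  have "r A \<le> r (A \<union> D)" if "finite D" "D \<subseteq> E" for D
    using that
  proof (induction D rule: finite_induct)
    case empty
    then show ?case by simp
  next
    case (insert e D)
    have "r (A \<union> D) \<le> r (insert e (A \<union> D))"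
    proof (cases "e \<in> A \<union> D")
      case True
      then show ?thesis by (simp add: insert_absorb)
    next
      case False
      then show ?thesis using insert assms by (intro assms(2)) auto
    qed
    then show ?case
      using insert by simp
  qed
  moreover have "finite B" "A \<union> B = B"
    using assms finite_subset by auto
  ultimately show ?thesis
    using assms(4) by metis
qed

lemma k_polymatroidD:
  assumes "is_k_polymatroid k (E, \<rho>)"
  shows "finite E" "\<rho> {} = 0"
    and "\<And>A B. A \<subseteq> B \<Longrightarrow> B \<subseteq> E \<Longrightarrow> \<rho> A \<le> \<rho> B"
    and "\<And>A B. A \<subseteq> E \<Longrightarrow> B \<subseteq> E \<Longrightarrow> \<rho> (A \<inter> B) + \<rho> (A \<union> B) \<le> \<rho> A + \<rho> B"
    and "\<And>e. e \<in> E \<Longrightarrow> \<rho> {e} \<le> int k"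
    and "\<And>A. A \<subseteq> E \<Longrightarrow> 0 \<le> \<rho> A"
proof -
  have P: "finite E" "\<rho> {} = 0" "\<forall>A B. A \<subseteq> B \<and> B \<subseteq> E \<longrightarrow> \<rho> A \<le> \<rho> B"
    "\<forall>A B. A \<subseteq> E \<and> B \<subseteq> E \<longrightarrow> \<rho> A + \<rho> B \<ge> \<rho> (A \<inter> B) + \<rho> (A \<union> B)"
    "\<forall>e\<in>E. \<rho> {e} \<le> int k"
    using assms by (simp_all only: is_k_polymatroid.simps is_polymatroid.simps) (elim conjE, assumption)+
  show "finite E" "\<rho> {} = 0"
    by (fact P)+
  show mono: "\<rho> A \<le> \<rho> B" if "A \<subseteq> B" "B \<subseteq> E" for A B
    by (rule P(3)[rule_format]) (use that in simp)
  show "\<rho> (A \<inter> B) + \<rho> (A \<union> B) \<le> \<rho> A + \<rho> B" if "A \<subseteq> E" "B \<subseteq> E" for A B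
    by (rule P(4)[rule_format]) (use that in simp)
  show "\<rho> {e} \<le> int k" if "e \<in> E" for e
    using P(5) that by (rule bspec)
  show "0 \<le> \<rho> A" if "A \<subseteq> E" for A
    using mono[OF empty_subsetI that] P(2) by simp
qed

lemma matroid_rank_Un_le:
  assumes "is_k_polymatroid 1 (E, r)" "A \<subseteq> E" "D \<subseteq> E"
  shows "r (A \<union> D) \<le> r A + int (card D)"
proof -
  have "finite D"
    using assms finite_subset by auto
  then show ?thesis
    using \<open>D \<subseteq> E\<close>
  proof (induction D rule: finite_induct)
    case empty
    then show ?case by simp
  next
    case (insert e D)
    have sub: "A \<union> D \<subseteq> E" "{e} \<subseteq> E"
      using insert assms by auto
    then have "r ((A \<union> D) \<inter> {e}) + r ((A \<union> D) \<union> {e}) \<le> r (A \<union> D) + r {e}"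
      using assms(1) by (auto simp del: Un_insert_right)
    moreover have "0 \<le> r ((A \<union> D) \<inter> {e})"
      using k_polymatroidD(6)[OF assms(1)] sub by blast
    moreover have "r {e} \<le> 1"
      using assms(1) insert.prems by simp
    ultimately show ?case
      using insert by simp
  qed
qed

lemma series_parallel_is_k_polymatroid:
  assumes k: "k \<ge> 1" and M: "is_k_polymatroid 1 (E, r)"
    and \<rho>: "\<And>A. A \<subseteq> E \<Longrightarrow> \<rho> A = series_parallel k S r A"
  shows "is_k_polymatroid k (E, \<rho>)"
proof -
  have fin: "finite A" if "A \<subseteq> E" for A
    using M that finite_subset by auto
  have mono: "\<rho> A \<le> \<rho> B" if "A \<subseteq> B" "B \<subseteq> E" for A B
  proof -
    have "r A \<le> r B"
      using M that by auto
    moreover have "card (A \<inter> S) \<le> card (B \<inter> S)"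
      using that fin by (intro card_mono) auto
    ultimately show ?thesis
      using that \<rho>[of A] \<rho>[of B] k by (auto simp: series_parallel_def intro!: add_mono mult_left_mono)
  qed
  have submod: "\<rho> (A \<inter> B) + \<rho> (A \<union> B) \<le> \<rho> A + \<rho> B" if "A \<subseteq> E" "B \<subseteq> E" for A B
  proof -
    have "r (A \<inter> B) + r (A \<union> B) \<le> r A + r B"
      using M that by auto
    moreover note card_Int_modular[OF fin[OF that(1)] fin[OF that(2)], of "int k - 1" S]
    moreover have "A \<inter> B \<subseteq> E" "A \<union> B \<subseteq> E"
      using that by auto
    ultimately show ?thesis
      using that \<rho> by (simp add: series_parallel_def)
  qed
  have "\<rho> {e} \<le> int k" if "e \<in> E" for e
  proof -
    have "r {e} \<le> 1"
      using M that by simp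
    moreover have "card ({e} \<inter> S) \<le> 1"
      using card_mono[of "{e}" "{e} \<inter> S"] by simp
    then have "(int k - 1) * int (card ({e} \<inter> S)) \<le> (int k - 1) * 1"
      using k by (intro mult_left_mono) auto
    ultimately show ?thesis
      using \<rho>[of "{e}"] that by (simp add: series_parallel_def)
  qed
  moreover have "\<rho> {} = 0" "finite E"
    using M \<rho>[of "{}"] by (auto simp: series_parallel_def)
  ultimately show ?thesis
    using mono submod by simp
qed

text \<open>
  If all proper minors have binary natural matroids, the marginal rank of an element never leaves the range
  \<open>{0, 1}\<close> or \<open>{k - 1, k}\<close> in which it starts: a single element excludes the values between, and
  a pair of elements excludes a jump from the upper range to the lower one. Subtracting \<open>k - 1\<close> for
  each element in the upper range therefore leaves marginal ranks \<open>0\<close> and \<open>1\<close>, hence a matroid.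
\<close>

lemma matroid_of_binary_proper_minors:
  fixes E :: "'a set"
  assumes k: "k \<ge> 3" and P: "is_k_polymatroid k (E, \<rho>)" and card: "card E \<ge> 3"
    and minors: "\<And>Q. proper_minor Q (E, \<rho>) \<Longrightarrow> in_P_U24 k Q"
  obtains S r where "S \<subseteq> E" "is_k_polymatroid 1 (E, r)" "\<rho> = series_parallel k S r"
proof -
  define S where "S = {e \<in> E. \<rho> {e} \<ge> int k - 1}"
  define r where "r A = \<rho> A - (int k - 1) * int (card (A \<inter> S))" for A
  have fin: "finite E" and \<rho>0: "\<rho> {} = 0"
    using P by auto
  have mono: "\<rho> A \<le> \<rho> B" if "A \<subseteq> B" "B \<subseteq> E" for A B
    using P that by auto
  have submod: "\<rho> (A \<inter> B) + \<rho> (A \<union> B) \<le> \<rho> A + \<rho> B" if "A \<subseteq> E" "B \<subseteq> E" for A B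
    using P that by auto
  have minor: "in_P_U24 k (Z, \<lambda>X. \<rho> (Y \<union> X) - \<rho> Y)"
    if "Y \<subseteq> E" "Z \<subseteq> E" "Y \<inter> Z = {}" "card Z < card E" for Y Z
  proof (rule minors)
    have "E - (E - Z - Y) - Y = Z"
      using that by auto
    moreover have "(E - Z - Y) \<union> Y \<noteq> {}"
      using that by auto
    ultimately show "proper_minor (Z, \<lambda>X. \<rho> (Y \<union> X) - \<rho> Y) (E, \<rho>)"
      unfolding proper_minor_def using that
      by (intro exI[of _ "E - Z - Y"] exI[of _ Y]) auto
  qed
  have single: "\<rho> (insert e Y) - \<rho> Y \<le> 1 \<or> \<rho> (insert e Y) - \<rho> Y \<ge> int k - 1"
    if "e \<in> E" "Y \<subseteq> E - {e}" for e Y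
    using single_rank_of_in_P_U24[OF minor[of Y "{e}"]] that card by auto
  have pair: "\<rho> (insert e (insert f Y)) - \<rho> (insert f Y) \<ge> int k - 1"
    if "e \<in> E" "f \<in> E" "e \<noteq> f" "Y \<subseteq> E - {e, f}" "\<rho> (insert e Y) - \<rho> Y \<ge> int k - 1" for e f Y
    using pair_rank_of_in_P_U24[OF minor[of Y "{e, f}"]] that card k by auto
  have upper: "\<rho> (insert e Y) - \<rho> Y \<ge> int k - 1" if "e \<in> S" "Y \<subseteq> E - {e}" for e Y
  proof -
    have "finite Y"
      using that(2) fin finite_subset by blast
    then show ?thesis
      using that(2)
    proof (induction Y rule: finite_induct)
      case empty
      then show ?case using that(1) \<rho>0 by (simp add: S_def)
    next
      case (insert f Y)
      then show ?case using that(1) by (intro pair) (auto simp: S_def)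
    qed
  qed
  have marginal: "\<rho> (insert e Y) - \<rho> Y \<le> \<rho> {e}" if "e \<in> E" "Y \<subseteq> E - {e}" for e Y
  proof -
    have "Y \<inter> {e} = {}" "Y \<union> {e} = insert e Y" "Y \<subseteq> E" "{e} \<subseteq> E"
      using that by auto
    then show ?thesis
      using submod[of Y "{e}"] \<rho>0 by simp
  qed
  have lower: "\<rho> {e} \<le> 1" if "e \<in> E - S" for e
    using single[of e "{}"] that \<rho>0 by (auto simp: S_def)
  have step: "r A \<le> r (insert e A)" if "A \<subseteq> E" "e \<in> E - A" for A e
  proof (cases "e \<in> S")
    case True
    have "finite (A \<inter> S)"
      using that fin finite_subset by blast
    then have "card (insert e A \<inter> S) = card (A \<inter> S) + 1"
      using True that by simp
    moreover have "\<rho> (insert e A) - \<rho> A \<ge> int k - 1"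
      using upper[OF True, of A] that by blast
    ultimately show ?thesis
      by (simp add: r_def algebra_simps)
  next
    case False
    then show ?thesis
      using mono[of A "insert e A"] that by (auto simp: r_def)
  qed
  have matroid: "is_k_polymatroid 1 (E, r)"
    unfolding is_k_polymatroid.simps is_polymatroid.simps
  proof (intro conjI allI impI ballI)
    show "r A \<le> r B" if "A \<subseteq> B \<and> B \<subseteq> E" for A B
      using rank_mono_of_increments[of E r A B] fin step that by blast
    show "r (A \<inter> B) + r (A \<union> B) \<le> r A + r B" if "A \<subseteq> E \<and> B \<subseteq> E" for A B
    proof -
      have "finite A" "finite B"
        using that fin finite_subset by blast+
      then show ?thesis
        using submod[of A B] that card_Int_modular[of A B "int k - 1" S] by (simp add: r_def)
    qed
    show "r {e} \<le> int 1" if "e \<in> E" for e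
    proof (cases "e \<in> S")
      case True
      then show ?thesis using P that by (simp add: r_def)
    next
      case False
      then show ?thesis using lower that by (simp add: r_def)
    qed
  qed (use fin \<rho>0 in \<open>simp_all add: r_def\<close>)
  show ?thesis
  proof (rule that[OF _ matroid])
    show "S \<subseteq> E"
      unfolding S_def by blast
    show "\<rho> = series_parallel k S r"
      by (rule ext) (simp add: series_parallel_def r_def)
  qed
qed

text \<open>
  In the natural matroid of a series-parallel extension, \<open>X\<close> spans an element \<open>e\<close> of the underlying
  matroid as soon as it contains one copy (\<open>e\<close> replaced in parallel), respectively only if it
  contains all copies (\<open>e\<close> replaced in series).
\<close>

definition spanned_part :: "nat \<Rightarrow> 'a set \<Rightarrow> ('a \<times> nat) set \<Rightarrow> 'a set" where
  "spanned_part k S X = {e. if e \<in> S then \<forall>i<k. (e, i) \<in> X else \<exists>i. (e, i) \<in> X}"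

text \<open>
  The copies in series that contribute one to the rank each. Of a complete series class the last
  copy is left out, because it is accounted for by the element of the underlying matroid.
\<close>

definition free_part :: "nat \<Rightarrow> 'a set \<Rightarrow> ('a \<times> nat) set \<Rightarrow> ('a \<times> nat) set" where
  "free_part k S X = {(e, i) \<in> X. e \<in> S \<and> (e \<in> spanned_part k S X \<longrightarrow> Suc i < k)}"

lemma spanned_part_subset:
  assumes "k \<ge> 1" "X \<subseteq> E \<times> {..<k}"
  shows "spanned_part k S X \<subseteq> E"
proof
  fix e assume "e \<in> spanned_part k S X"
  then have "(e, 0) \<in> X \<or> (\<exists>i. (e, i) \<in> X)"
    using assms(1) by (auto simp: spanned_part_def split: if_splits)
  then show "e \<in> E"
    using assms(2) by blast
qed

lemma free_part_class_le:
  assumes "k \<ge> 1" "X \<subseteq> E \<times> {..<k}" "e \<in> S"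
  shows "card {i. (e, i) \<in> free_part k S X} \<le> k - 1"
proof -
  have "{i. (e, i) \<in> free_part k S X} \<subset> {..<k}"
  proof (cases "e \<in> spanned_part k S X")
    case True
    then have "k - 1 \<notin> {i. (e, i) \<in> free_part k S X}"
      by (auto simp: free_part_def)
    moreover have "{i. (e, i) \<in> free_part k S X} \<subseteq> {..<k}"
      using assms by (auto simp: free_part_def)
    ultimately show ?thesis
      using assms(1) by (metis diff_less lessThan_iff less_le_trans psubsetI zero_less_one)
  next
    case False
    then obtain i where "i < k" "(e, i) \<notin> X"
      using assms(3) by (auto simp: spanned_part_def)
    then show ?thesis
      using assms(2) by (auto simp: free_part_def)
  qed
  then have "card {i. (e, i) \<in> free_part k S X} < k"
    using psubset_card_mono[of "{..<k}"] by simp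
  then show ?thesis by simp
qed

text \<open>
  The minimum is attained at the spanned part. For any other \<open>A\<close>, a spanned element outside \<open>A\<close>
  costs at most one in rank and is paid for by a copy in \<open>X\<close>, while a series class inside \<open>A\<close>
  contributes at most \<open>k - 1\<close> to the free part.
\<close>

lemma natural_rank_series_parallel:
  assumes k: "k \<ge> 1" and M: "is_k_polymatroid 1 (E, r)"
    and \<rho>: "\<And>A. A \<subseteq> E \<Longrightarrow> \<rho> A = series_parallel k S r A"
    and X: "X \<subseteq> E \<times> {..<k}"
  shows "Min {\<rho> A + int (card (X - A \<times> {..<k})) | A. A \<subseteq> E}
    = r (spanned_part k S X) + int (card (free_part k S X))"
proof -
  define F where "F = spanned_part k S X"
  define R where "R = free_part k S X"
  note finE = k_polymatroidD(1)[OF M]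
  have finX: "finite X"
    using X finE finite_subset by blast
  have RX: "R \<subseteq> X"
    by (auto simp: R_def free_part_def)
  have finR: "finite R"
    using RX finX finite_subset by blast
  have FE: "F \<subseteq> E"
    unfolding F_def by (rule spanned_part_subset[OF k X])
  have finF: "finite F"
    using FE finE finite_subset by blast
  show ?thesis
    unfolding F_def[symmetric] R_def[symmetric]
  proof (rule natural_rank_eqI[OF finE _ FE])
    have "R \<inter> F \<times> {..<k} = (F \<inter> S) \<times> {..<k - 1}"
      using k by (auto simp: R_def free_part_def F_def spanned_part_def)
    then have "card (R \<inter> F \<times> {..<k}) = card (F \<inter> S) * (k - 1)"
      by (simp add: card_cartesian_product)
    moreover have "X - F \<times> {..<k} = R - F \<times> {..<k}"
      using X by (auto simp: R_def free_part_def F_def spanned_part_def)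
    moreover have "card R = card (R \<inter> F \<times> {..<k}) + card (R - F \<times> {..<k})"
      using finR by (simp add: card_Int_Diff)
    ultimately show "\<rho> F + int (card (X - F \<times> {..<k})) = r F + int (card R)"
      using \<rho>[OF FE] k by (simp add: series_parallel_def of_nat_diff)
  next
    fix A assume A: "A \<subseteq> E"
    have finA: "finite A"
      using A finE finite_subset by blast
    have "r F \<le> r (A \<union> (F - A))"
      using A FE k_polymatroidD(3)[OF M] by auto
    also have "\<dots> \<le> r A + int (card (F - A))"
      using A FE by (intro matroid_rank_Un_le[OF M]) auto
    finally have rF: "r F \<le> r A + int (card (F - A))" .
    have inside: "card (R \<inter> A \<times> {..<k}) \<le> card (A \<inter> S) * (k - 1)"
    proof -
      have "R \<inter> A \<times> {..<k} \<subseteq> Sigma (A \<inter> S) (\<lambda>e. {i. (e, i) \<in> R})"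
        by (auto simp: R_def free_part_def)
      moreover have finc: "finite {i. (e, i) \<in> R}" for e
        using finite_imageI[OF finR, of snd] by (rule rev_finite_subset) force
      ultimately have "card (R \<inter> A \<times> {..<k}) \<le> card (Sigma (A \<inter> S) (\<lambda>e. {i. (e, i) \<in> R}))"
        using finA by (intro card_mono) auto
      also have "\<dots> = (\<Sum>e\<in>A \<inter> S. card {i. (e, i) \<in> R})"
        using finA finc by (simp add: card_SigmaI)
      also have "\<dots> \<le> card (A \<inter> S) * (k - 1)"
        unfolding R_def using sum_bounded_above[of "A \<inter> S" _ "k - 1"] free_part_class_le[OF k X]
        by (metis (no_types, lifting) IntD2 of_nat_id)
      finally show ?thesis .
    qed
    have "\<exists>i. (e, i) \<in> X - R" if "e \<in> F" for e
      using that k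
      by (cases "e \<in> S") (auto simp: F_def R_def free_part_def spanned_part_def intro!: exI[of _ "k - 1"])
    then obtain c where c: "\<And>e. e \<in> F \<Longrightarrow> (e, c e) \<in> X - R"
      by metis
    have "card ((R - A \<times> {..<k}) \<union> (\<lambda>e. (e, c e)) ` (F - A)) \<le> card (X - A \<times> {..<k})"
      using c RX finX by (intro card_mono) auto
    moreover have "card ((R - A \<times> {..<k}) \<union> (\<lambda>e. (e, c e)) ` (F - A))
        = card (R - A \<times> {..<k}) + card ((\<lambda>e. (e, c e)) ` (F - A))"
      using c finR finF by (intro card_Un_disjoint) auto
    moreover have "card ((\<lambda>e. (e, c e)) ` (F - A)) = card (F - A)"
      by (rule card_image) (simp add: inj_on_def)
    ultimately have outside: "card (R - A \<times> {..<k}) + card (F - A) \<le> card (X - A \<times> {..<k})"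
      by simp
    have "card R = card (R \<inter> A \<times> {..<k}) + card (R - A \<times> {..<k})"
      using finR by (simp add: card_Int_Diff)
    then have "card R + card (F - A) \<le> card (A \<inter> S) * (k - 1) + card (X - A \<times> {..<k})"
      using inside outside by linarith
    moreover have "int (card (A \<inter> S) * (k - 1)) = (int k - 1) * int (card (A \<inter> S))"
      using k by (simp add: of_nat_diff)
    ultimately have "int (card R) + int (card (F - A))
        \<le> (int k - 1) * int (card (A \<inter> S)) + int (card (X - A \<times> {..<k}))"
      by linarith
    then show "r F + int (card R) \<le> \<rho> A + int (card (X - A \<times> {..<k}))"
      using rF \<rho>[OF A] by (simp add: series_parallel_def)
  qed
qed

lemma sum_fun_apply: "(\<Sum>x\<in>A. f x) j = (\<Sum>x\<in>A. f x j)"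
  by (induction A rule: infinite_finite_induct) auto

text \<open>
  A representation of the underlying matroid extends: parallel copies get the vector of their
  element, and the copies in series get fresh unit vectors except for the last one, which is chosen
  to make all copies together add up to the vector of their element.
\<close>

lemma binary_natural_matroid_series_parallel:
  assumes k: "k \<ge> 1" and M: "is_k_polymatroid 1 (E, r)"
    and \<rho>: "\<And>A. A \<subseteq> E \<Longrightarrow> \<rho> A = series_parallel k S r A"
    and bin: "binary (E, r)"
  shows "binary (natural_matroid k (E, \<rho>))"
proof -
  note finE = k_polymatroidD(1)[OF M]
  obtain n and u :: "'a \<Rightarrow> nat \<Rightarrow> bit" where u0: "\<And>x i. x \<in> E \<Longrightarrow> n \<le> i \<Longrightarrow> u x i = 0"
    and u: "\<And>A. A \<subseteq> E \<Longrightarrow> r A = int (seq.dim (u ` A))"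
    by (rule binaryE[OF bin]) blast
  \<comment> \<open>A fresh coordinate \<open>q (e, i)\<close>, not used by \<open>u\<close>, for every copy.\<close>
  obtain q0 :: "'a \<times> nat \<Rightarrow> nat" where q0: "inj_on q0 (E \<times> {..<k})"
    using finE finite_imp_inj_to_nat_seg[of "E \<times> {..<k}"] by blast
  define q where "q x = n + q0 x" for x
  have q_inj: "q x = q y \<longleftrightarrow> x = y" if "x \<in> E \<times> {..<k}" "y \<in> E \<times> {..<k}" for x y
    using q0 that by (auto simp: q_def inj_on_def)
  have uq: "u e (q x) = 0" if "e \<in> E" for e x
    using u0 that by (simp add: q_def)
  obtain N where N: "\<And>x. x \<in> E \<times> {..<k} \<Longrightarrow> q x < N"
    using finE finite_nat_set_iff_bounded[of "q ` (E \<times> {..<k})"] by auto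
  define b :: "'a \<times> nat \<Rightarrow> nat \<Rightarrow> bit" where "b x = (\<lambda>j. if j = q x then 1 else 0)" for x
  define s where "s e = (\<Sum>i<k - 1. b (e, i))" for e
  define v where "v = (\<lambda>(e, i). if e \<notin> S then u e else if Suc i < k then b (e, i) else u e + s e)"
  have bq: "b x (q y) = (if x = y then 1 else 0)" if "x \<in> E \<times> {..<k}" "y \<in> E \<times> {..<k}" for x y
    using q_inj[OF that(2,1)] by (auto simp: b_def)
  have sq: "s e (q (e', i)) = (if e = e' \<and> Suc i < k then 1 else 0)" if "e \<in> E" "e' \<in> E" "i < k" for e e' i
  proof -
    have "s e (q (e', i)) = (\<Sum>i'<k - 1. if (e, i') = (e', i) then 1 else 0)"
      unfolding s_def sum_fun_apply by (rule sum.cong) (use that bq in auto)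
    also have "\<dots> = (if e = e' \<and> Suc i < k then 1 else 0)"
      by (cases "e = e'") auto
    finally show ?thesis .
  qed
  have v0: "v x j = 0" if xE: "x \<in> E \<times> {..<k}" and j: "max n N \<le> j" for x j
  proof -
    obtain e i where x: "x = (e, i)" "e \<in> E" "i < k"
      using xE by auto
    have "b (e, i') j = 0" if "i' < k" for i'
      using N[of "(e, i')"] x(2) that j by (auto simp: b_def)
    then show ?thesis
      using x u0[of e j] j by (simp add: v_def s_def sum_fun_apply)
  qed
  have rank: "Min {\<rho> A + int (card (X - A \<times> {..<k})) | A. A \<subseteq> E} = int (seq.dim (v ` X))"
    if X: "X \<subseteq> E \<times> {..<k}" for X
  proof -
    define F where "F = spanned_part k S X"
    define R where "R = free_part k S X"
    have FE: "F \<subseteq> E"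
      unfolding F_def by (rule spanned_part_subset[OF k X])
    have RX: "R \<subseteq> X"
      by (auto simp: R_def free_part_def)
    have fin: "finite X" "finite F" "finite R"
      using finite_subset[OF X] finite_subset[OF FE finE] finite_subset[OF RX] finE by simp_all
    have s_span: "s e \<in> seq.span (v ` R)" if "e \<in> F" "e \<in> S" for e
      unfolding s_def
    proof (rule seq.span_sum)
      fix i assume "i \<in> {..<k - 1}"
      then have "b (e, i) = v (e, i)" "(e, i) \<in> R"
        using that by (auto simp: v_def R_def free_part_def F_def spanned_part_def)
      then show "b (e, i) \<in> seq.span (v ` R)"
        by (metis image_eqI seq.span_base)
    qed
    have "seq.span (v ` X) = seq.span (u ` F \<union> v ` R)"
    proof (rule subset_antisym; rule seq.span_minimal[OF _ seq.subspace_span]; rule subsetI)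
      fix y assume "y \<in> v ` X"
      then obtain e i where ei: "(e, i) \<in> X" "y = v (e, i)"
        by auto
      show "y \<in> seq.span (u ` F \<union> v ` R)"
      proof (cases "(e, i) \<in> R")
        case True
        then show ?thesis
          using ei by (auto intro: seq.span_base)
      next
        case False
        then have eF: "e \<in> F" "e \<in> S \<Longrightarrow> \<not> Suc i < k"
          using ei by (auto simp: R_def free_part_def F_def spanned_part_def)
        then have "u e \<in> seq.span (u ` F \<union> v ` R)"
          by (auto intro: seq.span_base)
        moreover have "s e \<in> seq.span (u ` F \<union> v ` R)" if "e \<in> S"
          using s_span[OF eF(1) that] seq.span_mono[of "v ` R" "u ` F \<union> v ` R"] by auto
        ultimately show ?thesis
          using ei(2) eF(2) by (auto simp: v_def intro: seq.span_add)
      qed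
    next
      fix y assume "y \<in> u ` F \<union> v ` R"
      moreover have "u e \<in> seq.span (v ` X)" if e: "e \<in> F" for e
      proof (cases "e \<in> S")
        case True
        have "(e, k - 1) \<in> X"
          using True e k by (auto simp: F_def spanned_part_def)
        then have "v (e, k - 1) \<in> seq.span (v ` X)"
          by (intro seq.span_base imageI)
        moreover have "s e \<in> seq.span (v ` X)"
          using s_span[OF e True] seq.span_mono[of "v ` R" "v ` X"] RX by auto
        ultimately have "v (e, k - 1) - s e \<in> seq.span (v ` X)"
          by (rule seq.span_diff)
        moreover have "v (e, k - 1) = u e + s e"
          using True k by (simp add: v_def)
        ultimately show ?thesis
          by (simp only: add_diff_cancel_right')
      next
        case False
        then obtain i where "(e, i) \<in> X"
          using e by (auto simp: F_def spanned_part_def)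
        then have "v (e, i) \<in> seq.span (v ` X)"
          by (intro seq.span_base imageI)
        then show ?thesis
          using False by (simp add: v_def)
      qed
      ultimately show "y \<in> seq.span (v ` X)"
        using RX by (auto intro: seq.span_base)
    qed
    then have "seq.dim (v ` X) = seq.dim (u ` F \<union> v ` R)"
      by (rule seq.span_eq_dim)
    also have "\<dots> = seq.dim (u ` F) + card R"
    proof -
      \<comment> \<open>Copies other than the last come first: each owns its coordinate. The last copy of an
        incomplete class then owns the coordinate of a copy that is missing from \<open>X\<close>.\<close>
      define R1 where "R1 = {x \<in> R. Suc (snd x) < k}"
      define R2 where "R2 = {x \<in> R. \<not> Suc (snd x) < k}"
      have R1: "e \<in> E" "e \<in> S" "Suc i < k" if "(e, i) \<in> R1" for e i
        using that X RX by (auto simp: R1_def R_def free_part_def)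
      have R2: "e \<in> E" "e \<in> S" "i = k - 1" "e \<notin> F" if "(e, i) \<in> R2" for e i
      proof -
        show "e \<in> E" "e \<in> S" "e \<notin> F"
          using that X RX by (auto simp: R2_def R_def free_part_def F_def)
        have "(e, i) \<in> E \<times> {..<k}" "\<not> Suc i < k"
          using that X RX by (auto simp: R2_def)
        then show "i = k - 1"
          by auto
      qed
      have "\<exists>i. Suc i < k \<and> (e, i) \<notin> X" if e: "(e, k - 1) \<in> R2" for e
      proof -
        obtain i where i: "i < k" "(e, i) \<notin> X"
          using R2(2)[OF e] R2(4)[OF e] by (auto simp: F_def spanned_part_def)
        moreover have "(e, k - 1) \<in> X"
          using e RX by (auto simp: R2_def)
        ultimately have "i \<noteq> k - 1"
          by auto
        then show ?thesis
          using i by (intro exI[of _ i]) auto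
      qed
      then obtain t where t: "\<And>e. (e, k - 1) \<in> R2 \<Longrightarrow> Suc (t e) < k \<and> (e, t e) \<notin> X"
        by metis
      have finR: "finite R1" "finite R2"
        using fin(3) by (simp_all add: R1_def R2_def)
      have R12: "R = R1 \<union> R2" "R1 \<inter> R2 = {}"
        by (auto simp: R1_def R2_def)
      have v1: "v x = b x" "x \<in> E \<times> {..<k}" if "x \<in> R1" for x
        using that R1[of "fst x" "snd x"] by (cases x; simp add: v_def)+
      have v2: "v (e, i) = u e + s e" if "(e, i) \<in> R2" for e i
        using R2[OF that] k by (simp add: v_def)
      have "seq.dim ((u ` F \<union> v ` R1) \<union> v ` R2) = seq.dim (u ` F \<union> v ` R1) + card R2"
      proof (rule dim_union_private_coordinates[where p = "\<lambda>x. q (fst x, t (fst x))"])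
        fix x assume x: "x \<in> R2"
        obtain e i where e: "x = (e, i)"
          by fastforce
        note e' = R2[OF x[unfolded e]]
        have t': "Suc (t e) < k" "(e, t e) \<notin> X"
          using t[of e] x e e'(3) by auto
        show "v x (q (fst x, t (fst x))) \<noteq> 0"
          using v2[OF x[unfolded e]] e uq[OF e'(1)] sq[OF e'(1) e'(1), of "t e"] t' by simp
        {
          fix y assume y: "y \<in> R2" "y \<noteq> x"
          obtain e2 i2 where e2: "y = (e2, i2)"
            by fastforce
          note e2' = R2[OF y(1)[unfolded e2]]
          show "v y (q (fst x, t (fst x))) = 0"
            using v2[OF y(1)[unfolded e2]] e2 e uq[OF e2'(1)] sq[OF e2'(1) e'(1), of "t e"] t' y(2) e'(3) e2'(3)
            by auto
        }
        {
          fix y assume "y \<in> u ` F \<union> v ` R1"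
          then show "y (q (fst x, t (fst x))) = 0"
          proof
            assume "y \<in> u ` F"
            then show ?thesis using FE uq by auto
          next
            assume "y \<in> v ` R1"
            then obtain e2 i2 where e2: "y = v (e2, i2)" "(e2, i2) \<in> R1"
              by auto
            have "(e2, i2) \<noteq> (e, t e)"
              using e2(2) t'(2) RX by (auto simp: R1_def)
            then show ?thesis
              using e2(1) v1[OF e2(2)] bq[of "(e2, i2)" "(e, t e)"] t' e e'(1) by auto
          qed
        }
      qed (use fin finR in auto)
      also have "seq.dim (u ` F \<union> v ` R1) = seq.dim (u ` F) + card R1"
      proof (rule dim_union_private_coordinates[where p = q])
        show "v x (q x) \<noteq> 0" if "x \<in> R1" for x
          using v1[OF that] bq[of x x] by simp
        show "v y (q x) = 0" if "y \<in> R1" "x \<in> R1" "y \<noteq> x" for x y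
          using v1[OF that(1)] v1[OF that(2)] bq[of y x] that(3) by simp
        show "y (q x) = 0" if "y \<in> u ` F" for x y
          using that FE uq by (cases x) auto
      qed (use fin finR in auto)
      finally show ?thesis
        using R12 finR by (simp add: image_Un Un_assoc card_Un_disjoint)
    qed
    finally show ?thesis
      using natural_rank_series_parallel[OF k M \<rho> X] u[OF FE] by (simp add: F_def R_def)
  qed
  show ?thesis
    unfolding natural_matroid.simps by (rule binaryI[OF v0 rank])
qed

section \<open>Matroids on at most four elements\<close>

lemma k_polymatroid_minor:
  assumes P: "is_k_polymatroid k (E, \<rho>)" and sub: "Y \<subseteq> E" "Z \<subseteq> E"
  shows "is_k_polymatroid k (Z, \<lambda>X. \<rho> (Y \<union> X) - \<rho> Y)"
  unfolding is_k_polymatroid.simps is_polymatroid.simps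
proof (intro conjI allI impI ballI)
  show "finite Z"
    using sub(2) k_polymatroidD(1)[OF P] by (rule finite_subset)
  show "\<rho> (Y \<union> {}) - \<rho> Y = 0"
    by simp
  show "\<rho> (Y \<union> A) - \<rho> Y \<le> \<rho> (Y \<union> B) - \<rho> Y" if "A \<subseteq> B \<and> B \<subseteq> Z" for A B
  proof -
    have "\<rho> (Y \<union> A) \<le> \<rho> (Y \<union> B)"
      by (rule k_polymatroidD(3)[OF P]) (use that sub in blast)+
    then show ?thesis by simp
  qed
  show "\<rho> (Y \<union> A \<inter> B) - \<rho> Y + (\<rho> (Y \<union> (A \<union> B)) - \<rho> Y) \<le> \<rho> (Y \<union> A) - \<rho> Y + (\<rho> (Y \<union> B) - \<rho> Y)"
    if "A \<subseteq> Z \<and> B \<subseteq> Z" for A B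
  proof -
    have "\<rho> ((Y \<union> A) \<inter> (Y \<union> B)) + \<rho> ((Y \<union> A) \<union> (Y \<union> B)) \<le> \<rho> (Y \<union> A) + \<rho> (Y \<union> B)"
      by (rule k_polymatroidD(4)[OF P]) (use that sub in blast)+
    moreover have "(Y \<union> A) \<inter> (Y \<union> B) = Y \<union> A \<inter> B" "(Y \<union> A) \<union> (Y \<union> B) = Y \<union> (A \<union> B)"
      by blast+
    ultimately show ?thesis by simp
  qed
  show "\<rho> (Y \<union> {e}) - \<rho> Y \<le> int k" if "e \<in> Z" for e
  proof -
    have sub': "{e} \<subseteq> E" "Y \<inter> {e} \<subseteq> E"
      using that sub by auto
    have "\<rho> (Y \<inter> {e}) + \<rho> (Y \<union> {e}) \<le> \<rho> Y + \<rho> {e}"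
      by (rule k_polymatroidD(4)[OF P sub(1) sub'(1)])
    moreover have "0 \<le> \<rho> (Y \<inter> {e})"
      by (rule k_polymatroidD(6)[OF P sub'(2)])
    moreover have "\<rho> {e} \<le> int k"
      using k_polymatroidD(5)[OF P] sub' by blast
    ultimately show ?thesis by linarith
  qed
qed

lemma k_polymatroid_restrict:
  assumes "is_k_polymatroid k (E, \<rho>)" "Z \<subseteq> E"
  shows "is_k_polymatroid k (Z, \<rho>)"
  using k_polymatroid_minor[OF assms(1) empty_subsetI assms(2)] k_polymatroidD(2)[OF assms(1)] by simp

lemma binary_iso:
  assumes "(E, r) \<cong>\<^sub>p (F, s)" "binary (F, s)"
  shows "binary (E, r)"
proof -
  obtain \<phi> where \<phi>: "bij_betw \<phi> E F" "\<And>X. X \<subseteq> E \<Longrightarrow> s (\<phi> ` X) = r X"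
    using assms(1) by auto
  obtain n and v :: "'b \<Rightarrow> nat \<Rightarrow> bit" where v: "\<And>x i. x \<in> F \<Longrightarrow> n \<le> i \<Longrightarrow> v x i = 0"
    "\<And>X. X \<subseteq> F \<Longrightarrow> s X = int (seq.dim (v ` X))"
    by (rule binaryE[OF assms(2)]) blast
  have im: "\<phi> ` X \<subseteq> F" if "X \<subseteq> E" for X
    using \<phi>(1) that by (auto simp: bij_betw_def)
  have "(v \<circ> \<phi>) x i = 0" if "x \<in> E" "n \<le> i" for x i
    using v(1) im[of "{x}"] that by simp
  moreover have "r X = int (seq.dim ((v \<circ> \<phi>) ` X))" if "X \<subseteq> E" for X
    using v(2)[OF im[OF that]] \<phi>(2)[OF that] by (simp add: image_comp)
  ultimately show ?thesis
    by (rule binaryI)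
qed

text \<open>
  A zero vector or a repeated vector does not change any span, and a new unit vector raises every
  dimension by one. Hence loops, parallel elements and coloops can be added to a representation.
\<close>

lemma binary_add_loop:
  assumes M: "is_k_polymatroid 1 (E, r)" and e: "e \<in> E" "r {e} = 0" and bin: "binary (E - {e}, r)"
  shows "binary (E, r)"
proof -
  obtain n and v :: "'a \<Rightarrow> nat \<Rightarrow> bit" where v: "\<And>x i. x \<in> E - {e} \<Longrightarrow> n \<le> i \<Longrightarrow> v x i = 0"
    "\<And>X. X \<subseteq> E - {e} \<Longrightarrow> r X = int (seq.dim (v ` X))"
    by (rule binaryE[OF bin]) blast
  define w where "w = v(e := 0)"
  have "r X = int (seq.dim (w ` X))" if "X \<subseteq> E" for X
  proof (cases "e \<in> X")
    case False
    then have "w ` X = v ` X"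
      unfolding w_def by (intro image_cong) auto
    moreover have "X \<subseteq> E - {e}"
      using that False by blast
    ultimately show ?thesis
      using v(2)[of X] by simp
  next
    case True
    define Y where "Y = X - {e}"
    have Y: "X = insert e Y" "e \<notin> Y" "Y \<subseteq> E - {e}"
      using True that by (auto simp: Y_def)
    have "r X \<le> r Y"
      using k_polymatroidD(4)[OF M, of Y "{e}"] k_polymatroidD(2)[OF M] Y e by auto
    moreover have "r Y \<le> r X"
      using k_polymatroidD(3)[OF M, of Y X] Y that by auto
    moreover have "w ` X = insert 0 (v ` Y)"
      using Y(2) unfolding Y(1) by (auto simp: w_def)
    moreover have "seq.dim (insert 0 (v ` Y)) = seq.dim (v ` Y)"
      by (rule seq.span_eq_dim) (rule seq.span_insert_0)
    ultimately show ?thesis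
      using v(2)[OF Y(3)] by simp
  qed
  moreover have "w x i = 0" if "x \<in> E" "n \<le> i" for x i
    using v(1) that by (auto simp: w_def)
  ultimately show ?thesis
    by (rule binaryI[rotated])
qed

lemma binary_add_parallel:
  assumes M: "is_k_polymatroid 1 (E, r)" and e: "e \<in> E" and f: "f \<in> E - {e}"
    and parallel: "r {e, f} = r {e}" "r {e, f} = r {f}" and bin: "binary (E - {e}, r)"
  shows "binary (E, r)"
proof -
  obtain n and v :: "'a \<Rightarrow> nat \<Rightarrow> bit" where v: "\<And>x i. x \<in> E - {e} \<Longrightarrow> n \<le> i \<Longrightarrow> v x i = 0"
    "\<And>X. X \<subseteq> E - {e} \<Longrightarrow> r X = int (seq.dim (v ` X))"
    by (rule binaryE[OF bin]) blast
  define w where "w = v(e := v f)"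
  have absorb: "r (insert a (insert b Y)) = r (insert b Y)"
    if "Y \<subseteq> E" "a \<in> E" "b \<in> E" "r {a, b} = r {b}" for a b Y
  proof -
    have sub: "insert b Y \<subseteq> E" "{a, b} \<subseteq> E" "insert a (insert b Y) \<subseteq> E"
      using that by auto
    have "r (insert b Y \<inter> {a, b}) + r (insert b Y \<union> {a, b}) \<le> r (insert b Y) + r {a, b}"
      by (rule k_polymatroidD(4)[OF M sub(1,2)])
    moreover have "r {b} \<le> r (insert b Y \<inter> {a, b})"
      using sub by (intro k_polymatroidD(3)[OF M]) auto
    moreover have "insert b Y \<union> {a, b} = insert a (insert b Y)"
      by auto
    moreover have "r (insert b Y) \<le> r (insert a (insert b Y))"
      using sub by (intro k_polymatroidD(3)[OF M]) auto
    ultimately show ?thesis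
      using that(4) by simp
  qed
  have "r X = int (seq.dim (w ` X))" if "X \<subseteq> E" for X
  proof (cases "e \<in> X")
    case False
    then have "w ` X = v ` X"
      unfolding w_def by (intro image_cong) auto
    moreover have "X \<subseteq> E - {e}"
      using that False by blast
    ultimately show ?thesis
      using v(2)[of X] by simp
  next
    case True
    define Y where "Y = X - {e}"
    have Y: "X = insert e Y" "e \<notin> Y" "Y \<subseteq> E"
      using True that by (auto simp: Y_def)
    have "r X = r (insert f X)"
      using absorb[of Y f e] Y e f parallel by (simp add: insert_commute)
    also have "\<dots> = r (insert f Y)"
      using absorb[of Y e f] Y e f parallel by (simp add: insert_commute)
    also have "\<dots> = int (seq.dim (v ` insert f Y))"
      using Y f by (intro v(2)) auto
    also have "v ` insert f Y = w ` X"
      using Y(2) f unfolding Y(1) by (auto simp: w_def)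
    finally show ?thesis .
  qed
  moreover have "w x i = 0" if "x \<in> E" "n \<le> i" for x i
    using v(1) that f by (auto simp: w_def)
  ultimately show ?thesis
    by (rule binaryI[rotated])
qed

lemma binary_add_coloop:
  assumes M: "is_k_polymatroid 1 (E, r)" and e: "e \<in> E" "r (E - {e}) \<noteq> r E"
    and bin: "binary (E - {e}, r)"
  shows "binary (E, r)"
proof -
  obtain n and v :: "'a \<Rightarrow> nat \<Rightarrow> bit" where v: "\<And>x i. x \<in> E - {e} \<Longrightarrow> n \<le> i \<Longrightarrow> v x i = 0"
    "\<And>X. X \<subseteq> E - {e} \<Longrightarrow> r X = int (seq.dim (v ` X))"
    by (rule binaryE[OF bin]) blast
  define d :: "nat \<Rightarrow> bit" where "d = (\<lambda>i. if i = n then 1 else 0)"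
  define w where "w = v(e := d)"
  have "r X = int (seq.dim (w ` X))" if "X \<subseteq> E" for X
  proof (cases "e \<in> X")
    case False
    then have "w ` X = v ` X"
      unfolding w_def by (intro image_cong) auto
    moreover have "X \<subseteq> E - {e}"
      using that False by blast
    ultimately show ?thesis
      using v(2)[of X] by simp
  next
    case True
    define Y where "Y = X - {e}"
    have Y: "X = insert e Y" "e \<notin> Y" "Y \<subseteq> E - {e}"
      using True that by (auto simp: Y_def)
    have "r (X \<inter> (E - {e})) + r (X \<union> (E - {e})) \<le> r X + r (E - {e})"
      using that by (intro k_polymatroidD(4)[OF M]) auto
    moreover have "X \<inter> (E - {e}) = Y" "X \<union> (E - {e}) = E"
      using that True e by (auto simp: Y_def)
    moreover have "r (E - {e}) \<le> r E"
      by (rule k_polymatroidD(3)[OF M]) auto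
    moreover have "r X \<le> r Y + 1"
      using matroid_rank_Un_le[OF M, of Y "{e}"] Y e by auto
    ultimately have "r X = r Y + 1"
      using e(2) by simp
    moreover have "w ` X = v ` Y \<union> (\<lambda>_. d) ` {e}"
      using Y(2) unfolding Y(1) by (auto simp: w_def)
    moreover have "seq.dim (v ` Y \<union> (\<lambda>_. d) ` {e}) = seq.dim (v ` Y) + card {e}"
    proof (rule dim_union_private_coordinates[where p = "\<lambda>_. n"])
      show "finite (v ` Y)"
        using Y k_polymatroidD(1)[OF M] finite_subset[of Y E] by auto
    qed (use v(1) Y in \<open>auto simp: d_def\<close>)
    ultimately show ?thesis
      using v(2)[OF Y(3)] by simp
  qed
  moreover have "w x i = 0" if "x \<in> E" "Suc n \<le> i" for x i
    using v(1) that by (auto simp: w_def d_def)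
  ultimately show ?thesis
    by (rule binaryI[rotated])
qed

lemma binary_rank_zero:
  assumes "\<And>X. X \<subseteq> E \<Longrightarrow> r X = 0"
  shows "binary (E, r)"
proof -
  define z :: "'a \<Rightarrow> nat \<Rightarrow> bit" where "z x = 0" for x
  have "seq.dim (z ` X) = 0" for X
  proof -
    have "z ` X \<subseteq> seq.span {}"
      by (auto simp: z_def)
    then have "seq.dim (z ` X) \<le> card ({} :: (nat \<Rightarrow> bit) set)"
      by (rule seq.dim_le_card) simp
    then show ?thesis by simp
  qed
  then show ?thesis
    using assms by (intro binaryI[of E 0 z]) (simp_all add: z_def)
qed

text \<open>An \<open>n\<close>-element circuit consists of \<open>n\<close> elements in series that replace a single loop.\<close>

lemma binary_circuit:
  assumes fin: "finite E" "E \<noteq> {}"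
    and r: "\<And>X. X \<subseteq> E \<Longrightarrow> r X = min (int (card X)) (int (card E) - 1)"
  shows "binary (E, r)"
proof -
  define n where "n = card E"
  have n: "n \<ge> 1"
    using fin by (simp add: n_def Suc_le_eq card_gt_0_iff)
  define \<rho> where "\<rho> = series_parallel n {()} (\<lambda>_. 0)"
  have loop: "is_k_polymatroid 1 ({()}, \<lambda>_. 0)"
    by simp
  have "binary ({()}, \<lambda>_. 0 :: int)"
    by (rule binary_rank_zero) simp
  then have bin: "binary (natural_matroid n ({()}, \<rho>))"
    by (intro binary_natural_matroid_series_parallel[OF n loop, where S = "{()}"]) (simp add: \<rho>_def)
  have nat: "Min {\<rho> A + int (card (X - A \<times> {..<n})) | A. A \<subseteq> {()}} = min (int (card X)) (int n - 1)"
    if X: "X \<subseteq> {()} \<times> {..<n}" for X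
  proof -
    have \<rho>: "\<rho> {} = 0" "\<rho> {()} = int n - 1"
      by (simp_all add: \<rho>_def series_parallel_def)
    have "X - {()} \<times> {..<n} = {}"
      using X by blast
    then have c: "card (X - {()} \<times> {..<n}) = 0" "card (X - {} \<times> {..<n}) = card X"
      by (simp_all only: card.empty Sigma_empty1 Diff_empty)
    have cases: "A = {} \<or> A = {()}" for A
      by auto
    have lower: "min (int (card X)) (int n - 1) \<le> \<rho> A + int (card (X - A \<times> {..<n}))" for A
      using cases[of A] \<rho> c by auto
    show ?thesis
    proof (cases "int (card X) \<le> int n - 1")
      case True
      show ?thesis
        by (rule natural_rank_eqI[where B = "{}", OF _ lower]) (use True \<rho> c in auto)
    next
      case False
      show ?thesis
        by (rule natural_rank_eqI[where B = "{()}", OF _ lower]) (use False \<rho> c in auto)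
    qed
  qed
  obtain h where h: "bij_betw h E {..<n}"
    using ex_bij_betw_finite_nat[OF fin(1)] by (auto simp: n_def atLeast0LessThan)
  have bij: "bij_betw (\<lambda>x. ((), h x)) E ({()} \<times> {..<n})"
    using h by (auto simp: bij_betw_def inj_on_def)
  have "(E, r) \<cong>\<^sub>p natural_matroid n ({()}, \<rho>)"
    unfolding natural_matroid.simps polymatroid_iso.simps
  proof (intro exI conjI allI impI, rule bij)
    fix X assume X: "X \<subseteq> E"
    have "card ((\<lambda>x. ((), h x)) ` X) = card X"
      using bij X by (meson bij_betw_def card_image inj_on_subset)
    moreover have "(\<lambda>x. ((), h x)) ` X \<subseteq> {()} \<times> {..<n}"
      using bij X by (auto simp: bij_betw_def)
    ultimately show "Min {\<rho> A + int (card ((\<lambda>x. ((), h x)) ` X - A \<times> {..<n})) | A. A \<subseteq> {()}} = r X"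
      using nat r[OF X] by (simp only: n_def)
  qed
  then show ?thesis
    using bin binary_iso unfolding natural_matroid.simps by blast
qed

lemma matroid_rank_bounds:
  assumes M: "is_k_polymatroid 1 (E, r)" and "X \<subseteq> E"
  shows "0 \<le> r X" "r X \<le> int (card X)" "r X \<le> r E"
proof -
  show "0 \<le> r X"
    by (rule k_polymatroidD(6)[OF M assms(2)])
  show "r X \<le> int (card X)"
    using matroid_rank_Un_le[OF M empty_subsetI assms(2)] k_polymatroidD(2)[OF M] by simp
  show "r X \<le> r E"
    by (rule k_polymatroidD(3)[OF M assms(2) subset_refl])
qed

text \<open>
  Loops, parallel elements and coloops can be deleted. A matroid on at most four elements that has
  none of them is empty, a circuit, or the four point line.
\<close>

lemma binary_of_card_le_4:
  assumes "is_k_polymatroid 1 (E, r)" "card E \<le> 4"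
    and "\<not> (card E = 4 \<and> (\<forall>X\<subseteq>E. r X = min (int (card X)) 2))"
  shows "binary (E, r)"
  using assms
proof (induction "card E" arbitrary: E rule: less_induct)
  case less
  note M = less.prems(1)
  note finE = k_polymatroidD(1)[OF M]
  have deletion: "binary (E - {e}, r)" if "e \<in> E" for e
  proof (rule less.hyps)
    show "card (E - {e}) < card E"
      using that finE by (meson card_Diff1_less)
    then show "card (E - {e}) \<le> 4" "\<not> (card (E - {e}) = 4 \<and> (\<forall>X\<subseteq>E - {e}. r X = min (int (card X)) 2))"
      using less.prems(2) by auto
    show "is_k_polymatroid 1 (E - {e}, r)"
      using M by (rule k_polymatroid_restrict) blast
  qed
  have one: "r {e} = 0 \<or> r {e} = 1" if "e \<in> E" for e
    using matroid_rank_bounds[OF M, of "{e}"] that by auto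
  show ?case
  proof (cases "\<exists>e\<in>E. r {e} = 0 \<or> r (E - {e}) \<noteq> r E \<or> (\<exists>f\<in>E - {e}. r {e, f} \<le> 1)")
    case True
    then obtain e where e: "e \<in> E"
      and alt: "r {e} = 0 \<or> r (E - {e}) \<noteq> r E \<or> (\<exists>f\<in>E - {e}. r {e, f} \<le> 1)"
      by blast
    consider "r {e} = 0" | "r (E - {e}) \<noteq> r E" | f where "f \<in> E - {e}" "r {f} = 0"
      | f where "f \<in> E - {e}" "r {e} = 1" "r {f} = 1" "r {e, f} \<le> 1"
      using alt one e by blast
    then show ?thesis
    proof cases
      case 1
      then show ?thesis using binary_add_loop[OF M] e deletion by blast
    next
      case 2
      then show ?thesis using binary_add_coloop[OF M] e deletion by blast
    next
      case (3 f)
      then show ?thesis using binary_add_loop[OF M] deletion by blast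
    next
      case (4 f)
      have "r {e} \<le> r {e, f}"
        using 4 e by (intro k_polymatroidD(3)[OF M]) auto
      then show ?thesis
        using binary_add_parallel[OF M e, of f] 4 deletion[OF e] by auto
    qed
  next
    case False
    then have loopless: "r {e} = 1" if "e \<in> E" for e
      using one that by blast
    have pairs: "r {e, f} = 2" if "e \<in> E" "f \<in> E" "e \<noteq> f" for e f
    proof -
      have "r {e, f} \<le> 2"
        using matroid_rank_bounds(2)[OF M, of "{e, f}"] that by auto
      moreover have "\<not> r {e, f} \<le> 1"
        using False that by blast
      ultimately show ?thesis by simp
    qed
    have nocoloop: "r (E - {e}) = r E" if "e \<in> E" for e
      using False that by blast
    show ?thesis
    proof (cases "E = {}")
      case True
      then show ?thesis
        using k_polymatroidD(2)[OF M] by (intro binary_rank_zero) simp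
    next
      case nonempty: False
      then obtain e where e: "e \<in> E"
        by blast
      have small: "r X = int (card X)" if X: "X \<subseteq> E" "card X \<le> 2" for X
      proof -
        have "finite X"
          using X(1) finE by (rule finite_subset)
        consider "card X = 0" | "card X = 1" | "card X = 2"
          using X(2) by linarith
        then show ?thesis
        proof cases
          case 1
          then show ?thesis
            using \<open>finite X\<close> k_polymatroidD(2)[OF M] by simp
        next
          case 2
          then obtain x where "X = {x}"
            by (rule card_1_singletonE)
          then show ?thesis
            using loopless X(1) by simp
        next
          case 3
          then obtain x y where "X = {x, y}" "x \<noteq> y"
            by (auto simp: card_2_iff)
          then show ?thesis
            using pairs X(1) by simp
        qed
      qed
      have top: "r E \<le> int (card E) - 1"
        using nocoloop[OF e] matroid_rank_bounds(2)[OF M, of "E - {e}"] e finE nonempty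
        by (simp add: of_nat_diff Suc_le_eq card_gt_0_iff)
      have big: "r X = r E" if X: "X \<subseteq> E" "card X + 1 \<ge> card E" for X
      proof (cases "X = E")
        case False
        then obtain f where f: "f \<in> E - X"
          using X by blast
        have "X = E - {f}"
          using X f finE by (intro card_seteq) (auto simp: card_Diff_singleton)
        then show ?thesis
          using nocoloop f by simp
      qed simp
      have circuit: "binary (E, r)" if "r E = int (card E) - 1"
      proof (rule binary_circuit[OF finE nonempty])
        fix X assume X: "X \<subseteq> E"
        have "card X \<le> card E"
          using X finE by (rule card_mono[rotated])
        then show "r X = min (int (card X)) (int (card E) - 1)"
          using small[OF X] big[OF X] that less.prems(2) by (cases "card X + 1 \<ge> card E") auto
      qed
      show ?thesis
      proof (cases "r E = int (card E) - 1")
        case False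
        have "r E \<ge> min (int (card E)) 2"
        proof -
          obtain Y where "Y \<subseteq> E" "card Y = min (card E) 2"
            using obtain_subset_with_card_n[of "min (card E) 2" E] by auto
          then show ?thesis
            using small[of Y] matroid_rank_bounds(3)[OF M, of Y] by auto
        qed
        then have four: "card E = 4" "r E = 2"
          using top False less.prems(2) by auto
        have "r X = min (int (card X)) 2" if X: "X \<subseteq> E" for X
        proof (cases "card X \<le> 2")
          case True
          then show ?thesis using small[OF X] by simp
        next
          case False
          then show ?thesis using big[OF X] four by simp
        qed
        then show ?thesis
          using less.prems(3) four by blast
      qed (rule circuit)
    qed
  qed
qed

section \<open>Excluded minors on four elements\<close>

text \<open>On a ground set of four elements this is the rank function of \<open>U\<^sub>2\<^sub>,\<^sub>4\<close>.\<close>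

definition line_rank :: "'a set \<Rightarrow> int" where
  "line_rank X = min (int (card X)) 2"

lemma line_rank_is_matroid:
  assumes "finite E"
  shows "is_k_polymatroid 1 (E, line_rank)"
  unfolding is_k_polymatroid.simps is_polymatroid.simps
proof (intro conjI allI impI ballI)
  show "line_rank A \<le> line_rank B" if "A \<subseteq> B \<and> B \<subseteq> E" for A B
  proof -
    have "card A \<le> card B"
      using that assms finite_subset by (blast intro: card_mono)
    then show ?thesis by (simp add: line_rank_def)
  qed
  show "line_rank (A \<inter> B) + line_rank (A \<union> B) \<le> line_rank A + line_rank B"
    if "A \<subseteq> E \<and> B \<subseteq> E" for A B
  proof -
    have fin: "finite A" "finite B"
      using that assms finite_subset by blast+
    have "card (A \<inter> B) \<le> card A" "card (A \<inter> B) \<le> card B"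
      using fin by (simp_all add: card_mono)
    then show ?thesis
      using card_Un_Int[OF fin] by (simp add: line_rank_def min_def)
  qed
qed (use assms in \<open>simp_all add: line_rank_def\<close>)

text \<open>Contracting all but one element of each series class leaves one copy of each point of the line.\<close>

lemma line_extension_not_in_P_U24:
  assumes k: "k \<ge> 1" and card: "card E = 4" and S: "S \<subseteq> E"
    and \<rho>: "\<And>X. X \<subseteq> E \<Longrightarrow> \<rho> X = series_parallel k S line_rank X"
  shows "\<not> in_P_U24 k (E, \<rho>)"
proof
  assume P: "in_P_U24 k (E, \<rho>)"
  have finE: "finite E"
    using card card_ge_0_finite by force
  define r where "r = (\<lambda>X. Min {\<rho> A + int (card (X - A \<times> {..<k})) | A. A \<subseteq> E})"
  have bin: "binary (E \<times> {..<k}, r)"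
    using P unfolding in_P_U24_def natural_matroid.simps r_def by blast
  define C where "C = S \<times> {..<k - 1}"
  have rank: "r (C \<union> A \<times> {k - 1}) = int (card C) + line_rank A" if A: "A \<subseteq> E" for A
  proof -
    define X where "X = C \<union> A \<times> {k - 1}"
    have X: "X \<subseteq> E \<times> {..<k}"
      using A S k by (auto simp: X_def C_def)
    have spanned: "spanned_part k S X = A"
    proof (rule set_eqI)
      fix e
      show "e \<in> spanned_part k S X \<longleftrightarrow> e \<in> A"
        using k by (cases "e \<in> S") (auto simp: spanned_part_def X_def C_def dest: spec[of _ "k - 1"])
    qed
    have "free_part k S X = C"
      unfolding free_part_def spanned by (auto simp: X_def C_def)
    then show ?thesis
      using natural_rank_series_parallel[OF k line_rank_is_matroid[OF finE] \<rho> X] spanned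
      by (simp add: r_def X_def)
  qed
  show False
  proof (rule not_binary_of_four_point_line[OF bin])
    show "card (E \<times> {k - 1}) = 4"
      using card by (simp add: card_cartesian_product)
    show "C \<subseteq> E \<times> {..<k}" "E \<times> {k - 1} \<subseteq> E \<times> {..<k}"
      using S k by (auto simp: C_def)
    fix X assume X: "X \<subseteq> E \<times> {k - 1}"
    define A where "A = fst ` X"
    have A: "A \<subseteq> E" "X = A \<times> {k - 1}"
      using X by (force simp: A_def)+
    have "r C = int (card C)"
      using rank[of "{}"] by (simp add: line_rank_def)
    moreover have "card X = card A"
      unfolding A(2) by (simp add: card_cartesian_product)
    ultimately show "r (C \<union> X) = r C + min (int (card X)) 2"
      using rank[OF A(1)] unfolding A(2)[symmetric] by (simp add: line_rank_def)
  qed (use finE in simp)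
qed

text \<open>
  Minors of a series-parallel extension are extensions of minors of the underlying matroid. A proper
  minor of the line has at most three elements and is therefore binary, so every extension of the
  line is an excluded minor.
\<close>

lemma excluded_minor_iff_line_extension:
  assumes k: "k \<ge> 3" and card: "card E = 4"
  shows "excluded_minor_P_U24 k (E, \<rho>) \<longleftrightarrow>
    (\<exists>S\<subseteq>E. \<forall>X\<subseteq>E. \<rho> X = series_parallel k S line_rank X)"
proof
  have k1: "k \<ge> 1"
    using k by simp
  have finE: "finite E"
    using card card_ge_0_finite by force
  {
    assume ex: "excluded_minor_P_U24 k (E, \<rho>)"
    have P: "is_k_polymatroid k (E, \<rho>)" and notin: "\<not> in_P_U24 k (E, \<rho>)"
      and minors: "\<And>Q. proper_minor Q (E, \<rho>) \<Longrightarrow> in_P_U24 k Q"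
      using ex by (auto simp only: excluded_minor_P_U24_def)
    obtain S r where S: "S \<subseteq> E" and M: "is_k_polymatroid 1 (E, r)" and \<rho>: "\<rho> = series_parallel k S r"
    proof (rule matroid_of_binary_proper_minors[OF k P _ minors])
      show "card E \<ge> 3"
        using card by simp
    qed
    have "\<not> binary (E, r)"
    proof
      assume "binary (E, r)"
      then have "binary (natural_matroid k (E, \<rho>))"
        by (intro binary_natural_matroid_series_parallel[OF k1 M, where S = S]) (simp_all only: \<rho>)
      then show False
        using notin P unfolding in_P_U24_def by blast
    qed
    then have "\<forall>X\<subseteq>E. r X = line_rank X"
      using binary_of_card_le_4[OF M] card unfolding line_rank_def by auto
    then show "\<exists>S\<subseteq>E. \<forall>X\<subseteq>E. \<rho> X = series_parallel k S line_rank X"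
      using S by (intro exI[of _ S]) (simp add: \<rho> series_parallel_def)
  }
  {
    assume "\<exists>S\<subseteq>E. \<forall>X\<subseteq>E. \<rho> X = series_parallel k S line_rank X"
    then obtain S where S: "S \<subseteq> E" and \<rho>: "\<And>X. X \<subseteq> E \<Longrightarrow> \<rho> X = series_parallel k S line_rank X"
      by blast
    have "in_P_U24 k Q" if Q: "proper_minor Q (E, \<rho>)" for Q
    proof -
      obtain X Y where XY: "X \<subseteq> E" "Y \<subseteq> E" "X \<inter> Y = {}" "X \<union> Y \<noteq> {}"
        and Q: "Q = (E - X - Y, \<lambda>Z. \<rho> (Y \<union> Z) - \<rho> Y)"
        using Q by (auto simp: proper_minor_def)
      define Z where "Z = E - X - Y"
      define r :: "'a set \<Rightarrow> int" where "r A = line_rank (Y \<union> A) - line_rank Y" for A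
      have Z: "Z \<subseteq> E" "Z \<noteq> E" "Y \<inter> Z = {}"
        using XY by (auto simp: Z_def)
      then have "card Z < card E"
        using finE by (intro psubset_card_mono) auto
      then have small: "card Z \<le> 3"
        using card by simp
      have M: "is_k_polymatroid 1 (Z, r)"
        unfolding r_def by (rule k_polymatroid_minor[OF line_rank_is_matroid[OF finE] XY(2) Z(1)])
      have bin: "binary (Z, r)"
        by (rule binary_of_card_le_4[OF M]) (use small in auto)
      have sp: "\<rho> (Y \<union> A) - \<rho> Y = series_parallel k S r A" if A: "A \<subseteq> Z" for A
      proof -
        have fin: "finite (Y \<inter> S)" "finite (A \<inter> S)"
          using finite_subset[OF XY(2) finE] finite_subset[OF subset_trans[OF A Z(1)] finE] by simp_all
        have "(Y \<union> A) \<inter> S = (Y \<inter> S) \<union> (A \<inter> S)" "(Y \<inter> S) \<inter> (A \<inter> S) = {}"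
          using A Z(3) by blast+
        then have "card ((Y \<union> A) \<inter> S) = card (Y \<inter> S) + card (A \<inter> S)"
          using fin by (simp add: card_Un_disjoint)
        moreover have "Y \<union> A \<subseteq> E"
          using XY(2) A Z(1) by blast
        ultimately show ?thesis
          using \<rho>[of Y] \<rho>[of "Y \<union> A"] XY(2) by (simp add: series_parallel_def r_def distrib_left)
      qed
      show ?thesis
        unfolding Q Z_def[symmetric] in_P_U24_def
        using series_parallel_is_k_polymatroid[OF k1 M sp]
          binary_natural_matroid_series_parallel[OF k1 M sp bin] by blast
    qed
    moreover have "is_k_polymatroid k (E, \<rho>)"
      by (rule series_parallel_is_k_polymatroid[OF k1 line_rank_is_matroid[OF finE] \<rho>])
    ultimately show "excluded_minor_P_U24 k (E, \<rho>)"
      using line_extension_not_in_P_U24[OF k1 card S \<rho>] unfolding excluded_minor_P_U24_def by blast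
  }
qed

text \<open>The line is symmetric, so only the number of series classes matters up to isomorphism.\<close>

lemma iso_line_extension_iff:
  assumes fin: "finite E" "finite F" and card: "card E = card F" and T: "T \<subseteq> F"
    and \<sigma>: "\<And>X. X \<subseteq> F \<Longrightarrow> \<sigma> X = series_parallel k T line_rank X"
  shows "(E, \<rho>) \<cong>\<^sub>p (F, \<sigma>) \<longleftrightarrow>
    (\<exists>S\<subseteq>E. card S = card T \<and> (\<forall>X\<subseteq>E. \<rho> X = series_parallel k S line_rank X))"
proof -
  have transfer: "\<sigma> (\<phi> ` X) = series_parallel k S line_rank X"
    if \<phi>: "bij_betw \<phi> E F" and S: "S = {e \<in> E. \<phi> e \<in> T}" and X: "X \<subseteq> E" for \<phi> S X
  proof -
    have inj: "inj_on \<phi> X" "inj_on \<phi> (X \<inter> S)"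
      using \<phi> X by (auto simp: bij_betw_def intro: inj_on_subset)
    have "\<phi> ` X \<inter> T = \<phi> ` (X \<inter> S)"
      using X by (auto simp: S)
    moreover have "\<phi> ` X \<subseteq> F"
      using \<phi> X by (auto simp: bij_betw_def)
    ultimately show ?thesis
      using \<sigma>[of "\<phi> ` X"] inj by (simp add: series_parallel_def line_rank_def card_image)
  qed
  show ?thesis
  proof
    assume "(E, \<rho>) \<cong>\<^sub>p (F, \<sigma>)"
    then obtain \<phi> where \<phi>: "bij_betw \<phi> E F" "\<And>X. X \<subseteq> E \<Longrightarrow> \<sigma> (\<phi> ` X) = \<rho> X"
      by auto
    define S where "S = {e \<in> E. \<phi> e \<in> T}"
    have "\<phi> ` S = T"
      using \<phi>(1) T by (auto simp: S_def bij_betw_def)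
    moreover have "inj_on \<phi> S"
      using \<phi>(1) by (auto simp: S_def bij_betw_def inj_on_def)
    ultimately have "card S = card T"
      using card_image by metis
    moreover have "S \<subseteq> E"
      by (auto simp: S_def)
    moreover have "\<rho> X = series_parallel k S line_rank X" if "X \<subseteq> E" for X
      using transfer[OF \<phi>(1) S_def that] \<phi>(2)[OF that] by simp
    ultimately show "\<exists>S\<subseteq>E. card S = card T \<and> (\<forall>X\<subseteq>E. \<rho> X = series_parallel k S line_rank X)"
      by blast
  next
    assume "\<exists>S\<subseteq>E. card S = card T \<and> (\<forall>X\<subseteq>E. \<rho> X = series_parallel k S line_rank X)"
    then obtain S where S: "S \<subseteq> E" "card S = card T"
      and \<rho>: "\<And>X. X \<subseteq> E \<Longrightarrow> \<rho> X = series_parallel k S line_rank X"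
      by blast
    have finS: "finite S" "finite T"
      using S(1) T fin finite_subset by blast+
    obtain h1 where h1: "bij_betw h1 S T"
      using finite_same_card_bij[OF finS S(2)] by blast
    have "card (E - S) = card (F - T)"
      using S T finS card by (simp add: card_Diff_subset)
    then obtain h2 where h2: "bij_betw h2 (E - S) (F - T)"
      using finite_same_card_bij[of "E - S" "F - T"] fin by blast
    define \<phi> where "\<phi> x = (if x \<in> S then h1 x else h2 x)" for x
    have b1: "bij_betw \<phi> S T"
      using h1 bij_betw_cong[of S \<phi> h1 T] by (simp add: \<phi>_def)
    have b2: "bij_betw \<phi> (E - S) (F - T)"
      using h2 bij_betw_cong[of "E - S" \<phi> h2 "F - T"] by (simp add: \<phi>_def)
    have "bij_betw \<phi> (S \<union> (E - S)) (T \<union> (F - T))"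
      by (rule bij_betw_combine[OF b1 b2]) blast
    moreover have "S \<union> (E - S) = E" "T \<union> (F - T) = F"
      using S(1) T by blast+
    ultimately have \<phi>: "bij_betw \<phi> E F"
      by simp
    have "S = {e \<in> E. \<phi> e \<in> T}"
      using S(1) b1 b2 by (auto simp: bij_betw_def)
    then have "\<sigma> (\<phi> ` X) = \<rho> X" if "X \<subseteq> E" for X
      using transfer[OF \<phi> _ that] \<rho>[OF that] by simp
    then show "(E, \<rho>) \<cong>\<^sub>p (F, \<sigma>)"
      using \<phi> by auto
  qed
qed

text \<open>Duality exchanges series and parallel classes, and the four point line is self-dual.\<close>

lemma k_dual_line_extension:
  assumes card: "card E = 4" and S: "S \<subseteq> E" and X: "X \<subseteq> E"
    and \<rho>: "\<And>X. X \<subseteq> E \<Longrightarrow> \<rho> X = series_parallel k S line_rank X"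
  shows "int k * int (card X) + \<rho> (E - X) - \<rho> E = series_parallel k (E - S) line_rank X"
proof -
  have fin: "finite E"
    using card card_ge_0_finite by force
  then have finX: "finite X" "finite S"
    using X S finite_subset by blast+
  have "card X \<le> 4"
    using card_mono[OF fin X] card by simp
  moreover have "card (E - X) = 4 - card X"
    using card_Diff_subset[OF finX(1) X] card by simp
  ultimately have line: "line_rank (E - X) = 2 - int (card X) + line_rank X" "line_rank E = 2"
    using card by (auto simp: line_rank_def min_def)
  have "S = (E - X) \<inter> S \<union> X \<inter> S" "((E - X) \<inter> S) \<inter> (X \<inter> S) = {}"
    using S by blast+
  then have "card S = card ((E - X) \<inter> S) + card (X \<inter> S)"
    using finX by (metis card_Un_disjoint finite_Int)
  then have a: "int (card ((E - X) \<inter> S)) = int (card S) - int (card (X \<inter> S))"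
    by simp
  have "X = X \<inter> (E - S) \<union> X \<inter> S" "(X \<inter> (E - S)) \<inter> (X \<inter> S) = {}"
    using X by blast+
  then have "card X = card (X \<inter> (E - S)) + card (X \<inter> S)"
    using finX by (metis card_Un_disjoint finite_Int)
  then have b: "int (card X) = int (card (X \<inter> (E - S))) + int (card (X \<inter> S))"
    by simp
  have "E \<inter> S = S"
    using S by blast
  then have "int k * int (card X) + \<rho> (E - X) - \<rho> E
      = int k * int (card X) + (2 - int (card X) + line_rank X)
        + (int k - 1) * (int (card S) - int (card (X \<inter> S))) - 2 - (int k - 1) * int (card S)"
    using \<rho>[of "E - X"] \<rho>[of E] line a by (simp add: series_parallel_def)
  also have "\<dots> = line_rank X + (int k - 1) * (int (card X) - int (card (X \<inter> S)))"
    by (simp add: algebra_simps)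
  also have "\<dots> = series_parallel k (E - S) line_rank X"
    using b by (simp add: series_parallel_def)
  finally show ?thesis .
qed

section \<open>The five excluded minors\<close>

definition is_line_extension :: "nat \<Rightarrow> 'a set \<Rightarrow> 'a polymatroid \<Rightarrow> bool" where
  "is_line_extension k S P \<longleftrightarrow> card (fst P) = 4 \<and> S \<subseteq> fst P \<and>
     (\<forall>X\<subseteq>fst P. snd P X = series_parallel k S line_rank X)"

lemma excluded_minor_iff_is_line_extension:
  assumes "k \<ge> 3" "card (fst P) = 4"
  shows "excluded_minor_P_U24 k P \<longleftrightarrow> (\<exists>S. is_line_extension k S P)"
  using excluded_minor_iff_line_extension[OF assms, of "snd P"] assms(2)
  by (simp add: is_line_extension_def)

lemma iso_iff_is_line_extension:
  assumes "card (fst P) = 4" "is_line_extension k T Q"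
  shows "P \<cong>\<^sub>p Q \<longleftrightarrow> (\<exists>S. is_line_extension k S P \<and> card S = card T)"
proof -
  obtain E \<rho> F \<sigma> where PQ: "P = (E, \<rho>)" "Q = (F, \<sigma>)"
    by (metis surj_pair)
  have card: "card E = 4" "card F = 4" and T: "T \<subseteq> F"
    and \<sigma>: "\<And>X. X \<subseteq> F \<Longrightarrow> \<sigma> X = series_parallel k T line_rank X"
    using assms by (simp_all add: PQ is_line_extension_def)
  have fin: "finite E" "finite F"
    using card card_ge_0_finite by force+
  have "card E = card F"
    using card by simp
  from iso_line_extension_iff[OF fin this T \<sigma>, of \<rho>] show ?thesis
    using card(1) by (auto simp add: PQ is_line_extension_def simp del: polymatroid_iso.simps)
qed

lemma k_dual_is_line_extension:
  assumes "is_line_extension k S P"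
  shows "is_line_extension k (fst P - S) (k_dual k P)"
proof -
  obtain E \<rho> where P: "P = (E, \<rho>)"
    by (metis surj_pair)
  have *: "card E = 4" "S \<subseteq> E" and \<rho>: "\<And>X. X \<subseteq> E \<Longrightarrow> \<rho> X = series_parallel k S line_rank X"
    using assms by (simp_all add: P is_line_extension_def)
  have "\<forall>X\<subseteq>E. int k * int (card X) + \<rho> (E - X) - \<rho> E = series_parallel k (E - S) line_rank X"
    using k_dual_line_extension[OF * _ \<rho>] by blast
  then show ?thesis
    using *(1) by (simp add: P is_line_extension_def)
qed

text \<open>The rank of the ground set is \<open>2 + (k - 1) |S|\<close>, which determines the size of \<open>S\<close>.\<close>

lemma card_series_classes_unique:
  assumes "k \<ge> 2" and S: "is_line_extension k S P" and T: "is_line_extension k T P"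
  shows "card S = card T"
proof -
  have "series_parallel k S line_rank (fst P) = series_parallel k T line_rank (fst P)"
    using S T unfolding is_line_extension_def by (metis subset_refl)
  moreover have "fst P \<inter> S = S" "fst P \<inter> T = T"
    using S T unfolding is_line_extension_def by blast+
  ultimately show ?thesis
    using assms(1) by (simp add: series_parallel_def)
qed

text \<open>
  Used as a rewrite rule, this decides the equations between explicit sets that arise when a rank
  table is looked up.
\<close>

lemma four_set_eq_iff:
  "X = Y \<longleftrightarrow> (e4 \<in> X \<longleftrightarrow> e4 \<in> Y) \<and> (f4 \<in> X \<longleftrightarrow> f4 \<in> Y) \<and> (g4 \<in> X \<longleftrightarrow> g4 \<in> Y) \<and> (h4 \<in> X \<longleftrightarrow> h4 \<in> Y)"
  (is "_ \<longleftrightarrow> ?R")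
proof
  assume ?R
  then have "x \<in> X \<longleftrightarrow> x \<in> Y" for x
    by (cases x) simp_all
  then show "X = Y"
    by blast
qed simp

lemma four_subsets:
  "(\<forall>X\<subseteq>{e4, f4, g4, h4}. Q X) \<longleftrightarrow>
    Q {} \<and> Q {e4} \<and> Q {f4} \<and> Q {g4} \<and> Q {h4} \<and>
    Q {e4, f4} \<and> Q {e4, g4} \<and> Q {e4, h4} \<and> Q {f4, g4} \<and> Q {f4, h4} \<and> Q {g4, h4} \<and>
    Q {e4, f4, g4} \<and> Q {e4, f4, h4} \<and> Q {e4, g4, h4} \<and> Q {f4, g4, h4} \<and> Q {e4, f4, g4, h4}"
proof -
  have "(\<forall>X\<subseteq>{e4, f4, g4, h4}. Q X) \<longleftrightarrow> (\<forall>X\<in>Pow {e4, f4, g4, h4}. Q X)"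
    by blast
  then show ?thesis
    by (simp only: Pow_insert Pow_empty image_insert image_empty ball_Un ball_simps Un_insert_left
        Un_empty_left insert_commute) blast
qed

lemma U24_is_line_extension: "is_line_extension k {} U24"
  by (simp add: is_line_extension_def series_parallel_def line_rank_def four_subsets four_set_eq_iff
      U24_def)

lemma Ex_3_0_1_is_line_extension: "is_line_extension k {h4} (Ex_3_0_1 k)"
  by (simp add: is_line_extension_def series_parallel_def line_rank_def four_subsets four_set_eq_iff
      Ex_3_0_1_def rank_table_def)

lemma Ex_2_0_2_is_line_extension: "is_line_extension k {g4, h4} (Ex_2_0_2 k)"
  by (simp add: is_line_extension_def series_parallel_def line_rank_def four_subsets four_set_eq_iff
      Ex_2_0_2_def rank_table_def)

lemma Ex_1_0_3_is_line_extension: "is_line_extension k {f4, g4, h4} (Ex_1_0_3 k)"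
  by (simp add: is_line_extension_def series_parallel_def line_rank_def four_subsets four_set_eq_iff
      Ex_1_0_3_def rank_table_def)

lemma Ex_0_0_4_is_line_extension: "is_line_extension k {e4, f4, g4, h4} (Ex_0_0_4 k)"
  by (simp add: is_line_extension_def series_parallel_def line_rank_def four_subsets four_set_eq_iff
      Ex_0_0_4_def)

lemmas five_line_extensions = U24_is_line_extension Ex_3_0_1_is_line_extension
  Ex_2_0_2_is_line_extension Ex_1_0_3_is_line_extension Ex_0_0_4_is_line_extension

theorem theorem6p0p1:
  fixes k :: nat
  assumes "k \<ge> 3"
  shows
    "(\<forall>P :: 'a polymatroid. card (fst P) = 4 \<longrightarrow>
        (excluded_minor_P_U24 k P \<longleftrightarrow>
           P \<cong>\<^sub>p U24 \<or> P \<cong>\<^sub>p Ex_3_0_1 k \<or> P \<cong>\<^sub>p Ex_2_0_2 k \<or> P \<cong>\<^sub>p Ex_1_0_3 k \<or> P \<cong>\<^sub>p Ex_0_0_4 k)) \<and>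
     (\<forall>Q \<in> {U24, Ex_3_0_1 k, Ex_2_0_2 k, Ex_1_0_3 k, Ex_0_0_4 k}. excluded_minor_P_U24 k Q) \<and>
     sorted_wrt (\<lambda>Q R. \<not> Q \<cong>\<^sub>p R) [U24, Ex_3_0_1 k, Ex_2_0_2 k, Ex_1_0_3 k, Ex_0_0_4 k] \<and>
     k_dual k U24 \<cong>\<^sub>p Ex_0_0_4 k \<and>
     k_dual k (Ex_3_0_1 k) \<cong>\<^sub>p Ex_1_0_3 k \<and>
     self_k_dual k (Ex_2_0_2 k) \<and>
     k_dual k (Ex_1_0_3 k) \<cong>\<^sub>p Ex_3_0_1 k \<and>
     k_dual k (Ex_0_0_4 k) \<cong>\<^sub>p U24"
proof -
  note five = five_line_extensions[of k]
  have cards: "card {h4} = 1" "card {g4, h4} = 2" "card {f4, g4, h4} = 3" "card {e4, f4, g4, h4} = 4"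
    by simp_all
  have four: "card (fst Q) = 4" if "is_line_extension k T Q" for T and Q :: "'b polymatroid"
    using that by (simp add: is_line_extension_def)
  have classes: "excluded_minor_P_U24 k P \<longleftrightarrow>
      P \<cong>\<^sub>p U24 \<or> P \<cong>\<^sub>p Ex_3_0_1 k \<or> P \<cong>\<^sub>p Ex_2_0_2 k \<or> P \<cong>\<^sub>p Ex_1_0_3 k \<or> P \<cong>\<^sub>p Ex_0_0_4 k"
    if P: "card (fst P) = 4" for P :: "'a polymatroid"
  proof -
    have "card S = 0 \<or> card S = 1 \<or> card S = 2 \<or> card S = 3 \<or> card S = 4"
      if "is_line_extension k S P" for S
    proof -
      have "finite (fst P)"
        using P card_ge_0_finite by force
      then have "card S \<le> card (fst P)"
        using that by (intro card_mono) (simp_all only: is_line_extension_def)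
      then show ?thesis
        using P by linarith
    qed
    then show ?thesis
      unfolding excluded_minor_iff_is_line_extension[OF assms P] five[THEN iso_iff_is_line_extension[OF P]]
        cards card.empty by blast
  qed
  have excluded: "excluded_minor_P_U24 k Q" if "is_line_extension k T Q" for T and Q :: "four polymatroid"
    using that excluded_minor_iff_is_line_extension[OF assms four[OF that]] by blast
  have iso: "Q \<cong>\<^sub>p R \<longleftrightarrow> card S = card T"
    if Q: "is_line_extension k S Q" and R: "is_line_extension k T R"
    for S T and Q R :: "four polymatroid"
  proof -
    have "card S' = card S" if "is_line_extension k S' Q" for S'
      using card_series_classes_unique[OF _ that Q] assms by simp
    then show ?thesis
      unfolding iso_iff_is_line_extension[OF four[OF Q] R] using Q by metis
  qed
  have dual: "is_line_extension k ({e4, f4, g4, h4} - S) (k_dual k Q)"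
    if Q: "is_line_extension k S Q" for S and Q :: "four polymatroid"
  proof -
    have "x \<in> {e4, f4, g4, h4}" for x
      by (cases x) simp_all
    then have "fst Q \<subseteq> {e4, f4, g4, h4}"
      by blast
    then have "fst Q = {e4, f4, g4, h4}"
      using four[OF Q] by (intro card_subset_eq) simp_all
    then show ?thesis
      using k_dual_is_line_extension[OF Q] by simp
  qed
  have "sorted_wrt (\<lambda>Q R. \<not> Q \<cong>\<^sub>p R) [U24, Ex_3_0_1 k, Ex_2_0_2 k, Ex_1_0_3 k, Ex_0_0_4 k]"
    by (simp add: iso[OF five(1) five(2)] iso[OF five(1) five(3)] iso[OF five(1) five(4)]
        iso[OF five(1) five(5)] iso[OF five(2) five(3)] iso[OF five(2) five(4)]
        iso[OF five(2) five(5)] iso[OF five(3) five(4)] iso[OF five(3) five(5)]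
        iso[OF five(4) five(5)])
  moreover have "\<forall>Q \<in> {U24, Ex_3_0_1 k, Ex_2_0_2 k, Ex_1_0_3 k, Ex_0_0_4 k}. excluded_minor_P_U24 k Q"
    using five[THEN excluded] by simp
  moreover have "k_dual k U24 \<cong>\<^sub>p Ex_0_0_4 k"
    by (simp add: iso[OF dual[OF five(1)] five(5)])
  moreover have "k_dual k (Ex_3_0_1 k) \<cong>\<^sub>p Ex_1_0_3 k"
    by (simp add: iso[OF dual[OF five(2)] five(4)])
  moreover have "self_k_dual k (Ex_2_0_2 k)"
    by (simp add: self_k_dual_def iso[OF five(3) dual[OF five(3)]])
  moreover have "k_dual k (Ex_1_0_3 k) \<cong>\<^sub>p Ex_3_0_1 k"
    by (simp add: iso[OF dual[OF five(4)] five(2)])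
  moreover have "k_dual k (Ex_0_0_4 k) \<cong>\<^sub>p U24"
    by (simp add: iso[OF dual[OF five(5)] five(1)])
  ultimately show ?thesis
    using classes by blast
qed

end
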